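(* Let $r,n$ be positive integers and $h\in\{0,1,\dots,r-1\}$. Let $k,b$ be integers with $1\le k\le n-1$ and $k\le b\le n$. Then the following identities hold (in the field of rational functions in $q$). (i) If $k$ is odd, then $$\sum_{\pi\in H_{r,n}(b-k+1\,:\,b)}\chi_{-1,h}(\pi)q^{\mathrm{fmaj}(\pi)}=\frac{[r]_{\zeta^h q}[2r]_{-\zeta^h q}\cdots[nr]_{(-1)^{n-1}\zeta^h q}}{[1]_{\zeta^h q}[2]_{-\zeta^h q}\cdots[k]_{(-1)^{k-1}\zeta^h q}}.$$ (ii) If $k$ is even and $n-b\equiv 0\pmod 2$, then $$\sum_{\pi\in H_{r,n}(b-k+1\,:\,b)}\chi_{-1,h}(\pi)q^{\mathrm{fmaj}(\pi)}=\frac{[r]_{\zeta^h q}[2r]_{-\zeta^h q}\cdots[nr]_{(-1)^{n-1}\zeta^h q}}{[1]_{\zeta^h q}[2]_{-\zeta^h q}\cdots[k+1]_{(-1)^{k}\zeta^h q}}\cdot[k+1]_{(-1)^n\zeta^h q}.$$ (iii) If $k$ is even and $n-b\equiv 1\pmod 2$, then $$\sum_{\pi\in H_{r,n}(b-k+1\,:\,b)}\chi_{-1,h}(\pi)q^{\mathrm{fmaj}(\pi)}=\frac{[r]_{\zeta^h q}[2r]_{-\zeta^h q}\cdots[nr]_{(-1)^{n-1}\zeta^h q}}{[1]_{\zeta^h q}[2]_{-\zeta^h q}\cdots[k+1]_{(-1)^{k}\zeta^h q}}\,\Big(2-[k+1]_{(-1)^n\zeta^h q}\Big).$$ In these formulas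 the $i$th factor of each numerator is $[ir]_{(-1)^{i-1}\zeta^h q}$ and the $i$th factor of each denominator is $[i]_{(-1)^{i-1}\zeta^h q}$.
   Context: Here $q$ is an indeterminate, $\zeta\in\mathbb{C}$ is a fixed primitive $r$th root of unity, and $[m]_x:=1+x+\cdots+x^{m-1}$ for an integer $m\ge 0$. $G_{r,n}=\mathbb{Z}_r\wr S_n$ is the group of colored permutations: its elements are $\pi=(\pi_1,\dots,\pi_n)=(\sigma_1^{z_1},\dots,\sigma_n^{z_n})$ with $\sigma=(\sigma_1,\dots,\sigma_n)\in S_n$ (one-line notation) and colors $z_i\in\{0,\dots,r-1\}$. Write $|\pi|=\sigma$ and $\mathrm{col}(\pi)=z_1+\cdots+z_n$ (sum of integers). A colored integer of color $0$ is written without exponent. For $\sigma\in S_n$, $\mathrm{inv}(\sigma)=\#\{i<j:\sigma_i>\sigma_j\}$. The one-dimensional character $\chi_{\epsilon,h}$ ($\epsilon\in\{1,-1\}$) is $\chi_{\epsilon,h}(\pi)=\epsilon^{\mathrm{inv}(|\pi|)}\zeta^{h\cdot\mathrm{col}(\pi)}$. Colored integers are compared in the linear order $$1^{r-1}<\cdots<n^{r-1}<\cdots<1^1<\cdots<n^1<1<\cdots<n.$$ With this order, $\mathrm{maj}_F(\pi)=\sum_{1\le i\le n-1,\ \pi_i>\pi_{i+1}}i$ and $\mathrm{fmaj}(\pi)=r\cdot\mathrm{maj}_F(\pi)+\mathrm{col}(\pi)$. For integers $1\le a\le c\le n$, $H_{r,n}(a:c)$ is the set of $\pi\in G_{r,n}$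 such that the permutation $|\pi|=(\sigma_1,\dots,\sigma_n)$ contains $(a,a+1,\dots,c)$ as a (not necessarily contiguous) subsequence; the colors are arbitrary. *)

theory Defs
  imports
    Complex_Main
    "HOL-Library.Sublist"
    "HOL-Combinatorics.Multiset_Permutations"
    "HOL-Computational_Algebra.Polynomial"
    "HOL-Computational_Algebra.Fraction_Field"
begin

text \<open>The colored integer $i^z$ is the pair \<open>(i, z)\<close>, and a colored permutation is given by its
  one-line notation, a list of colored integers.  List positions are counted from 0.\<close>

type_synonym colored_int = "nat \<times> nat"
type_synonym colored_perm = "colored_int list"

definition colored_perms :: "nat \<Rightarrow> nat \<Rightarrow> colored_perm set" where
  "colored_perms r n =
     {p. map fst p \<in> permutations_of_set {1..n} \<and> (\<forall>x \<in> set p. snd x < r)}"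

definition underlying :: "colored_perm \<Rightarrow> nat list" where
  "underlying p = map fst p"

definition col :: "colored_perm \<Rightarrow> nat" where
  "col p = (\<Sum>x\<leftarrow>p. snd x)"

definition inv_num :: "nat list \<Rightarrow> nat" where
  "inv_num s = card {(i, j). i < j \<and> j < length s \<and> s ! i > s ! j}"

text \<open>The order $1^{r-1} < \cdots < n^{r-1} < \cdots < 1^1 < \cdots < n^1 < 1 < \cdots < n$:
  a larger color makes a colored integer smaller.\<close>

definition colored_less :: "colored_int \<Rightarrow> colored_int \<Rightarrow> bool" where
  "colored_less x y \<longleftrightarrow> snd x > snd y \<or> (snd x = snd y \<and> fst x < fst y)"

text \<open>A descent $\pi_i > \pi_{i+1}$ with \<open>i\<close> counted from 1 compares the list entries
  \<open>i - 1\<close> and \<open>i\<close>.\<close>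

definition maj_F :: "colored_perm \<Rightarrow> nat" where
  "maj_F p = (\<Sum>i \<in> {i. 1 \<le> i \<and> i < length p \<and> colored_less (p ! i) (p ! (i - 1))}. i)"

definition fmaj :: "nat \<Rightarrow> colored_perm \<Rightarrow> nat" where
  "fmaj r p = r * maj_F p + col p"

definition primitive_root_of_unity :: "nat \<Rightarrow> complex \<Rightarrow> bool" where
  "primitive_root_of_unity r z \<longleftrightarrow> r > 0 \<and> z ^ r = 1 \<and> (\<forall>d. 0 < d \<and> d < r \<longrightarrow> z ^ d \<noteq> 1)"

text \<open>The character $\chi_{\epsilon,h}$ with respect to the primitive root of unity \<open>\<zeta>\<close>.\<close>

definition chi :: "complex \<Rightarrow> int \<Rightarrow> nat \<Rightarrow> colored_perm \<Rightarrow> complex" where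
  "chi \<zeta> \<epsilon> h p = of_int \<epsilon> ^ inv_num (underlying p) * \<zeta> ^ (h * col p)"

definition H_set :: "nat \<Rightarrow> nat \<Rightarrow> nat \<Rightarrow> nat \<Rightarrow> colored_perm set" where
  "H_set r n a c = {p \<in> colored_perms r n. subseq [a..<Suc c] (underlying p)}"

text \<open>The field of rational functions in the indeterminate \<open>q\<close> over the complex numbers.\<close>

type_synonym ratfun = "complex poly fract"

definition const :: "complex \<Rightarrow> ratfun" where
  "const c = Fract [:c:] 1"

definition q :: ratfun where
  "q = Fract [:0, 1:] 1"

definition bracket :: "nat \<Rightarrow> 'a::comm_semiring_1 \<Rightarrow> 'a" where
  "bracket m x = (\<Sum>i<m. x ^ i)"

lemma finite_colored_perms: "finite (colored_perms r n)"
proof (rule finite_subset)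
  show "colored_perms r n \<subseteq> {p. set p \<subseteq> {1..n} \<times> {..<r} \<and> length p = n}"
  proof
    fix p assume p: "p \<in> colored_perms r n"
    then have m: "map fst p \<in> permutations_of_set {1..n}"
      by (simp add: colored_perms_def)
    have "length p = n"
      using length_finite_permutations_of_set[OF m] by simp
    moreover have "fst ` set p = {1..n}"
      using permutations_of_setD(1)[OF m] by simp
    ultimately show "p \<in> {p. set p \<subseteq> {1..n} \<times> {..<r} \<and> length p = n}"
      using p by (force simp: colored_perms_def)
  qed
qed (auto intro: finite_lists_length_eq)

lemma finite_H_set: "finite (H_set r n a c)"
  using finite_colored_perms by (simp add: H_set_def)

end

theory Submission
  imports Defs
begin

text \<open>Since \<open>\<zeta> ^ r = 1\<close>, the weight of \<open>p\<close> is \<open>(-1) ^ inv_num (underlying p) * x ^ fmaj r p\<close> with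
  \<open>x = \<zeta> ^ h * q\<close>. Summing over the colors of a fixed permutation gives its major index generating
  function times \<open>\<Prod>i\<le>n. [r]\<close> at \<open>x ^ i\<close>, so only \<open>r = 1\<close> matters. Divided by \<open>\<Prod>i\<le>n. 1 - x ^ i\<close>,
  the sum then counts words \<open>f : {1..n} \<rightarrow> \<nat>\<close> that decrease weakly on the block \<open>{b - k + 1..b}\<close>, with the
  sign of their standardization. Splitting off the zero set of the word yields a recursion.
  Two neighbouring letters outside the block can be exchanged with a sign unless they carry equal values,
  so each such pair contributes a factor \<open>1 / (1 - x\<^sup>2)\<close>; this leaves at most one letter on either side of
  the block, where the recursion is solved explicitly.\<close>

section \<open>Summation over the colors\<close>

text \<open>The weight \<open>i\<close> of the first adjacent pair is a parameter to allow
  structural recursion; \<open>i = 1\<close> gives the major index.\<close>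

fun desc_sum :: "('a \<Rightarrow> 'a \<Rightarrow> bool) \<Rightarrow> nat \<Rightarrow> 'a list \<Rightarrow> nat" where
  "desc_sum R i [] = 0"
| "desc_sum R i [a] = 0"
| "desc_sum R i (a # b # xs) = (if R b a then i else 0) + desc_sum R (Suc i) (b # xs)"

text \<open>With \<open>Suc i\<close> as the weight of the first pair, the last pair has weight
  \<open>i + length xs\<close>, without any subtraction.\<close>

lemma desc_sum_snoc:
  "xs \<noteq> [] \<Longrightarrow> desc_sum R (Suc i) (xs @ [y]) =
     desc_sum R (Suc i) xs + (if R y (last xs) then i + length xs else 0)"
  by (induct R "Suc i" xs arbitrary: i rule: desc_sum.induct) auto

lemma sum_descents:
  "(\<Sum>i\<in>{i. 1 \<le> i \<and> i < length xs \<and> R (xs ! i) (xs ! (i - 1))}. i) = desc_sum R 1 xs"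
proof (induct xs rule: rev_induct)
  case (snoc y xs)
  show ?case
  proof (cases "xs = []")
    case False
    let ?D = "\<lambda>xs. {i. 1 \<le> i \<and> i < length xs \<and> R (xs ! i) (xs ! (i - 1))}"
    have "?D (xs @ [y]) = ?D xs \<union> (if R y (last xs) then {length xs} else {})"
      using False by (auto simp: nth_append last_conv_nth less_Suc_eq)
    then have "\<Sum>(?D (xs @ [y])) = \<Sum>(?D xs) + \<Sum>(if R y (last xs) then {length xs} else {})"
      by (simp only:) (rule sum.union_disjoint, auto)
    then show ?thesis
      using snoc False desc_sum_snoc[of xs R 0 y] by auto
  qed (simp add: numeral_eq_Suc)
qed auto

lemma maj_F_desc_sum: "maj_F p = desc_sum colored_less 1 p"
  unfolding maj_F_def by (rule sum_descents)

text \<open>With \<open>d\<close> the successive differences of the sequence \<open>snd (p ! j) + r * (number of descents weakly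
  to the right of j)\<close>, this is \<open>\<Sum>j. (i + j) * d j\<close>; for \<open>i = 1\<close> it telescopes to \<open>fmaj\<close>.\<close>

fun fmaj_diffs :: "nat \<Rightarrow> nat \<Rightarrow> colored_perm \<Rightarrow> nat" where
  "fmaj_diffs r i [] = 0"
| "fmaj_diffs r i [a] = i * snd a"
| "fmaj_diffs r i (a # b # p) =
     i * (snd a + (if colored_less b a then r else 0) - snd b) + fmaj_diffs r (Suc i) (b # p)"

text \<open>Abel summation: each color meets two neighbouring weights that differ by 1, and the
  boundary term \<open>i * snd a\<close> vanishes at \<open>i = 0\<close>. The bound on the colors
  makes every truncated difference exact.\<close>

lemma fmaj_diffs_Cons:
  assumes "\<forall>b \<in> set p. snd b < r"
  shows "fmaj_diffs r (Suc i) (a # p) =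
    i * snd a + r * desc_sum colored_less (Suc i) (a # p) + col (a # p)"
  using assms
proof (induct p arbitrary: i a)
  case (Cons b p)
  have "snd b \<le> snd a + (if colored_less b a then r else 0)"
    using Cons.prems by (auto simp: colored_less_def)
  then obtain d where d: "snd a + (if colored_less b a then r else 0) = snd b + d"
    using le_iff_add by blast
  have IH: "fmaj_diffs r (Suc (Suc i)) (b # p) =
      Suc i * snd b + r * desc_sum colored_less (Suc (Suc i)) (b # p) + col (b # p)"
    using Cons by simp
  have "Suc i * (snd a + (if colored_less b a then r else 0)) = Suc i * (snd b + d)"
    using d by simp
  then have "r * (if colored_less b a then Suc i else 0) + snd a + i * snd a = Suc i * snd b + Suc i * d"
    by (auto simp: algebra_simps)
  moreover have "fmaj_diffs r (Suc i) (a # b # p) = Suc i * d + fmaj_diffs r (Suc (Suc i)) (b # p)"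
    using d by simp
  ultimately show ?case
    using IH by (simp add: col_def distrib_left del: fmaj_diffs.simps)
qed (simp add: col_def)

lemma fmaj_eq_diffs: "\<forall>a \<in> set p. snd a < r \<Longrightarrow> fmaj r p = fmaj_diffs r 1 p"
  using fmaj_diffs_Cons[of "tl p" r 0 "hd p"]
  by (cases p) (simp_all add: fmaj_def maj_F_desc_sum col_def)

text \<open>The exponent is \<open>z - w\<close> reduced modulo \<open>r\<close>, except that at
  \<open>z = w\<close> the tie-break \<open>t < s\<close> decides between \<open>r\<close> and 0. So
  it runs through \<open>{1..r}\<close> or \<open>{0..<r}\<close>.\<close>

lemma sum_color_step:
  fixes y :: "'a::comm_semiring_1"
  assumes "w < r"
  shows "(\<Sum>z<r. y ^ (z + (if colored_less (t, w) (s, z) then r else 0) - w)) =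
    y ^ (if t < s then 1 else 0) * bracket r y"
  unfolding bracket_def sum_distrib_left power_add[symmetric]
  \<comment> \<open>In the inverse map one subtraction of \<open>r\<close> suffices, since
    \<open>d < 2 * r\<close>.\<close>
  by (rule sum.reindex_bij_witness[of _
        "\<lambda>e. let d = e + (if t < s then 1 else 0) + w in if d < r then d else d - r"
        "\<lambda>z. z + (if colored_less (t, w) (s, z) then r else 0) - w - (if t < s then 1 else 0)"])
    (use assms in \<open>auto simp: colored_less_def Let_def split: if_splits\<close>)

lemma sum_lists_Suc:
  "(\<Sum>zs\<in>{zs. set zs \<subseteq> A \<and> length zs = Suc m}. f zs) =
   (\<Sum>zs\<in>{zs. set zs \<subseteq> A \<and> length zs = m}. \<Sum>z\<in>A. f (z # zs))"
proof -
  let ?L = "\<lambda>m. {zs. set zs \<subseteq> A \<and> length zs = m}"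
  have "?L (Suc m) = (\<lambda>(zs, z). z # zs) ` (?L m \<times> A)"
    by (auto simp: image_iff length_Suc_conv)
  moreover have "inj_on (\<lambda>(zs, z). z # zs) (?L m \<times> A)"
    by (auto simp: inj_on_def)
  ultimately show ?thesis
    by (simp add: sum.reindex sum.cartesian_product split_def)
qed

text \<open>The head color enters only the first difference. Summed for a fixed second color it
  yields the factor \<open>bracket r (x ^ i)\<close> whatever that color is, so the colors can be
  split off from the left.\<close>

lemma sum_colorings:
  fixes x :: "'a::comm_ring_1"
  shows "(\<Sum>zs\<in>{zs. set zs \<subseteq> {..<r} \<and> length zs = length \<sigma>}. x ^ fmaj_diffs r i (zip \<sigma> zs)) =
    x ^ desc_sum (<) i \<sigma> * (\<Prod>j<length \<sigma>. bracket r (x ^ (i + j)))"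
proof (induct "(<) :: nat \<Rightarrow> nat \<Rightarrow> bool" i \<sigma> rule: desc_sum.induct)
  case (1 i)
  have "{zs. set zs \<subseteq> {..<r} \<and> length zs = 0} = {[]}" by auto
  then show ?case by simp
next
  case (2 i s)
  have "{zs. set zs \<subseteq> {..<r} \<and> length zs = 0} = {[]}" by auto
  then show ?case by (simp add: sum_lists_Suc bracket_def power_mult)
next
  case (3 i s t \<sigma>)
  let ?L = "{zs. set zs \<subseteq> {..<r} \<and> length zs = length (t # \<sigma>)}"
  let ?e = "if t < s then 1 else 0 :: nat"
  have step: "(\<Sum>z<r. x ^ fmaj_diffs r i (zip (s # t # \<sigma>) (z # zs))) =
      (x ^ i) ^ ?e * bracket r (x ^ i) * x ^ fmaj_diffs r (Suc i) (zip (t # \<sigma>) zs)"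
    if zs: "zs \<in> ?L" for zs
  proof -
    obtain w ws where [simp]: "zs = w # ws" using zs by (cases zs) auto
    have "w < r" using zs by auto
    have "(\<Sum>z<r. x ^ fmaj_diffs r i (zip (s # t # \<sigma>) (z # zs))) =
      (\<Sum>z<r. (x ^ i) ^ (z + (if colored_less (t, w) (s, z) then r else 0) - w)) *
        x ^ fmaj_diffs r (Suc i) (zip (t # \<sigma>) zs)"
      by (simp add: sum_distrib_right power_add power_mult)
    then show ?thesis using sum_color_step[OF \<open>w < r\<close>, of "x ^ i" t s] by simp
  qed
  have "(\<Sum>zs\<in>{zs. set zs \<subseteq> {..<r} \<and> length zs = length (s # t # \<sigma>)}.
      x ^ fmaj_diffs r i (zip (s # t # \<sigma>) zs)) =
      (\<Sum>zs\<in>?L. \<Sum>z<r. x ^ fmaj_diffs r i (zip (s # t # \<sigma>) (z # zs)))"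
    unfolding length_Cons[of s] by (rule sum_lists_Suc)
  also have "\<dots> = (\<Sum>zs\<in>?L. (x ^ i) ^ ?e * bracket r (x ^ i) *
      x ^ fmaj_diffs r (Suc i) (zip (t # \<sigma>) zs))"
    by (rule sum.cong[OF refl step])
  also have "\<dots> = (x ^ i) ^ ?e * bracket r (x ^ i) *
      (x ^ desc_sum (<) (Suc i) (t # \<sigma>) * (\<Prod>j<length (t # \<sigma>). bracket r (x ^ (Suc i + j))))"
    unfolding sum_distrib_left[symmetric] 3 ..
  also have "\<dots> = x ^ desc_sum (<) i (s # t # \<sigma>) *
      (\<Prod>j<length (s # t # \<sigma>). bracket r (x ^ (i + j)))"
    unfolding length_Cons[of s] prod.lessThan_Suc_shift
    by (simp add: power_add del: prod.lessThan_Suc)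
  finally show ?case .
qed

section \<open>Words and their zero sets\<close>

text \<open>The inversions between \<open>A\<close> and \<open>Z\<close> when all letters of
  \<open>A\<close> are written before those of \<open>Z\<close>.\<close>

definition cross :: "nat set \<Rightarrow> nat set \<Rightarrow> nat" where
  "cross A Z = card {(u, z). u \<in> A \<and> z \<in> Z \<and> z < u}"

text \<open>The increasing tail \<open>ys\<close> has no inversion inside, and distinctness lets
  pairs of positions across the cut be replaced by pairs of letters.\<close>

lemma inv_num_append_sorted:
  assumes "distinct (xs @ ys)" "sorted ys"
  shows "inv_num (xs @ ys) = inv_num xs + cross (set xs) (set ys)"
proof -
  let ?w = "xs @ ys" and ?m = "length xs"
  define P where "P = {(i, j). i < j \<and> j < length xs \<and> xs ! i > xs ! j}"
  define Q where "Q = {(i, j). i < ?m \<and> ?m \<le> j \<and> j < length ?w \<and> ?w ! i > ?w ! j}"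
  have "{(i, j). i < j \<and> j < length ?w \<and> ?w ! i > ?w ! j} = P \<union> Q"
  proof (rule antisym; rule subrelI)
    fix i j assume "(i, j) \<in> {(i, j). i < j \<and> j < length ?w \<and> ?w ! i > ?w ! j}"
    then have *: "i < j" "j < length ?w" "?w ! j < ?w ! i" by auto
    have "\<not> ?m \<le> i"
    proof
      assume "?m \<le> i"
      then have "ys ! (i - ?m) \<le> ys ! (j - ?m)"
        using * assms(2) by (intro sorted_nth_mono) auto
      then show False using * \<open>?m \<le> i\<close> by (simp add: nth_append)
    qed
    then show "(i, j) \<in> P \<union> Q" using * by (auto simp: P_def Q_def nth_append)
  qed (auto simp: P_def Q_def nth_append)
  moreover have "finite P" "finite Q" "P \<inter> Q = {}"
    by (auto simp: P_def Q_def intro: finite_subset[of _ "{..<?m} \<times> {..<?m}"]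
      finite_subset[of _ "{..<?m} \<times> {..<length ?w}"])
  moreover have "card Q = cross (set xs) (set ys)"
    unfolding cross_def
  proof (rule bij_betw_same_card[of "\<lambda>(i, j). (?w ! i, ?w ! j)"], rule bij_betw_imageI)
    show "inj_on (\<lambda>(i, j). (?w ! i, ?w ! j)) Q"
      using assms(1) by (auto simp: inj_on_def Q_def nth_eq_iff_index_eq)
    show "(\<lambda>(i, j). (?w ! i, ?w ! j)) ` Q = {(u, z). u \<in> set xs \<and> z \<in> set ys \<and> z < u}"
    proof (intro set_eqI iffI; clarify)
      fix u z assume "u \<in> set xs" "z \<in> set ys" "z < u"
      then obtain i j where "i < ?m" "xs ! i = u" "j < length ys" "ys ! j = z"
        by (auto simp: in_set_conv_nth)
      then show "(u, z) \<in> (\<lambda>(i, j). (?w ! i, ?w ! j)) ` Q"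
        using \<open>z < u\<close> by (intro image_eqI[of _ _ "(i, ?m + j)"]) (auto simp: Q_def nth_append)
    qed (auto simp: Q_def nth_append)
  qed
  ultimately show ?thesis
    by (simp add: inv_num_def card_Un_disjoint P_def)
qed

text \<open>The q-Pochhammer symbol \<open>(x; x)_n\<close>.\<close>

definition qpoch :: "'a::field \<Rightarrow> nat \<Rightarrow> 'a" where
  "qpoch x n = (\<Prod>i=1..n. 1 - x ^ i)"

lemma qpoch_0 [simp]: "qpoch x 0 = 1"
  by (simp add: qpoch_def)

lemma qpoch_Suc: "qpoch x (Suc n) = qpoch x n * (1 - x ^ Suc n)"
  by (simp add: qpoch_def)

lemma qpoch_nonzero: "(\<And>m. m \<ge> 1 \<Longrightarrow> x ^ m \<noteq> 1) \<Longrightarrow> qpoch x n \<noteq> 0"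
  by (simp add: qpoch_def)

text \<open>The generating function of the words over the naturals whose standardization is \<open>\<sigma>\<close>.\<close>

definition word_gf :: "'a::field \<Rightarrow> nat list \<Rightarrow> 'a" where
  "word_gf x \<sigma> = x ^ desc_sum (<) 1 \<sigma> / qpoch x (length \<sigma>)"

text \<open>The suffix \<open>drop i \<sigma>\<close> holds the positions at which the word vanishes; subtracting 1 from the other
  letters accounts for \<open>x ^ i\<close>.\<close>

lemma word_gf_rec:
  fixes x :: "'a::field"
  assumes nz: "\<And>m. m \<ge> 1 \<Longrightarrow> x ^ m \<noteq> 1"
  shows "word_gf x \<sigma> = (\<Sum>i | i \<le> length \<sigma> \<and> sorted (drop i \<sigma>). x ^ i * word_gf x (take i \<sigma>))"
proof (induct \<sigma> rule: rev_induct)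
  case Nil
  have "{i::nat. i = 0} = {0}" by auto
  then show ?case by (simp add: word_gf_def)
next
  case (snoc y \<sigma>)
  let ?n = "length \<sigma>"
  let ?I = "\<lambda>\<sigma>. {i. i \<le> length \<sigma> \<and> sorted (drop i \<sigma>)}"
  have nz': "1 - x ^ Suc ?n \<noteq> 0" "qpoch x ?n \<noteq> 0"
    using nz[of "Suc ?n"] qpoch_nonzero[OF nz] by auto
  have fin: "finite (?I \<sigma>)" by (rule finite_subset[of _ "{..?n}"]) auto
  show ?case
  proof (cases "\<sigma> \<noteq> [] \<and> y < last \<sigma>")
    case True
    \<comment> \<open>A final descent leaves only the increasing suffixes \<open>[y]\<close> and
      \<open>[]\<close>. The term of \<open>[]\<close> repeats the left-hand side with the factor
      \<open>x ^ Suc ?n\<close>, so the equation is solved for it.\<close>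
    have "?I (\<sigma> @ [y]) = {?n, Suc ?n}"
    proof (intro set_eqI iffI)
      fix i assume i: "i \<in> ?I (\<sigma> @ [y])"
      have "\<not> i < ?n"
      proof
        assume "i < ?n"
        then have "last \<sigma> \<in> set (drop i \<sigma>)"
          using last_in_set[of "drop i \<sigma>"] by simp
        then show False using i True \<open>i < ?n\<close> by (auto simp: sorted_append)
      qed
      then show "i \<in> {?n, Suc ?n}" using i by auto
    qed auto
    then have "(\<Sum>i\<in>?I (\<sigma> @ [y]). x ^ i * word_gf x (take i (\<sigma> @ [y]))) =
        x ^ ?n * word_gf x \<sigma> + x ^ Suc ?n * word_gf x (\<sigma> @ [y])"
      by simp
    moreover have "word_gf x (\<sigma> @ [y]) * (1 - x ^ Suc ?n) = x ^ ?n * word_gf x \<sigma>"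
      using nz' True desc_sum_snoc[of \<sigma> "(<)" 0 y]
      by (simp add: word_gf_def qpoch_Suc power_add del: power_Suc)
    ultimately show ?thesis by (simp add: algebra_simps)
  next
    case False
    \<comment> \<open>Without a final descent every increasing suffix of \<open>\<sigma>\<close> can
      be extended by \<open>y\<close>, and only the empty suffix is new.\<close>
    have "?I (\<sigma> @ [y]) = insert (Suc ?n) (?I \<sigma>)"
    proof (intro set_eqI iffI)
      fix i assume "i \<in> insert (Suc ?n) (?I \<sigma>)"
      moreover have "sorted (drop i \<sigma> @ [y])" if "i < ?n" "sorted (drop i \<sigma>)"
      proof -
        have "drop i \<sigma> \<noteq> []" "last (drop i \<sigma>) = last \<sigma>" "\<sigma> \<noteq> []" using that by auto
        then obtain ys where "drop i \<sigma> = ys @ [last \<sigma>]"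
          by (metis append_butlast_last_id)
        then show ?thesis
          using False that \<open>\<sigma> \<noteq> []\<close> by (auto simp: sorted_append not_less intro: order_trans)
      qed
      ultimately show "i \<in> ?I (\<sigma> @ [y])" by (cases "i = ?n") (auto simp: le_less)
    qed (auto simp: sorted_append le_Suc_eq)
    then have "(\<Sum>i\<in>?I (\<sigma> @ [y]). x ^ i * word_gf x (take i (\<sigma> @ [y]))) =
        x ^ Suc ?n * word_gf x (\<sigma> @ [y]) + (\<Sum>i\<in>?I \<sigma>. x ^ i * word_gf x (take i \<sigma>))"
      using fin by (simp del: power_Suc)
    moreover have "word_gf x (\<sigma> @ [y]) * (1 - x ^ Suc ?n) = word_gf x \<sigma>"
      using nz' False desc_sum_snoc[of \<sigma> "(<)" 0 y]
      by (cases "\<sigma> = []") (simp_all add: word_gf_def qpoch_Suc del: power_Suc)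
    ultimately show ?thesis using snoc by (simp add: algebra_simps)
  qed
qed

section \<open>Inversions between sets and signed sums over subsets\<close>

lemma cross_Un_left:
  assumes "finite A" "finite B" "finite Z" "A \<inter> B = {}"
  shows "cross (A \<union> B) Z = cross A Z + cross B Z"
proof -
  have "{(u, z). u \<in> A \<union> B \<and> z \<in> Z \<and> z < u} =
      {(u, z). u \<in> A \<and> z \<in> Z \<and> z < u} \<union> {(u, z). u \<in> B \<and> z \<in> Z \<and> z < u}" by auto
  then show ?thesis
    unfolding cross_def using assms
    by (simp only:) (rule card_Un_disjoint; auto intro: finite_subset[of _ "A \<times> Z"] finite_subset[of _ "B \<times> Z"])
qed

lemma cross_Un_right:
  assumes "finite A" "finite Y" "finite Z" "Y \<inter> Z = {}"
  shows "cross A (Y \<union> Z) = cross A Y + cross A Z"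
proof -
  have "{(u, z). u \<in> A \<and> z \<in> Y \<union> Z \<and> z < u} =
      {(u, z). u \<in> A \<and> z \<in> Y \<and> z < u} \<union> {(u, z). u \<in> A \<and> z \<in> Z \<and> z < u}" by auto
  then show ?thesis
    unfolding cross_def using assms
    by (simp only:) (rule card_Un_disjoint; auto intro: finite_subset[of _ "A \<times> Y"] finite_subset[of _ "A \<times> Z"])
qed

lemma cross_eq_0: "(\<And>u z. u \<in> A \<Longrightarrow> z \<in> Z \<Longrightarrow> u \<le> z) \<Longrightarrow> cross A Z = 0"
  unfolding cross_def by (metis (mono_tags, lifting) Collect_empty_eq card.empty case_prodE leD)

lemma cross_empty [simp]: "cross {} Z = 0" "cross A {} = 0"
  by (simp_all add: cross_def)

lemma cross_eq_mult:
  assumes "\<And>u z. u \<in> A \<Longrightarrow> z \<in> Z \<Longrightarrow> z < u"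
  shows "cross A Z = card A * card Z"
proof -
  have "{(u, z). u \<in> A \<and> z \<in> Z \<and> z < u} = A \<times> Z" using assms by auto
  then show ?thesis by (simp add: cross_def card_cartesian_product)
qed

lemma cross_insert_left:
  assumes "finite B" "finite Z" "v \<notin> B"
  shows "cross (insert v B) Z = cross {v} Z + cross B Z"
  unfolding insert_is_Un[of v B] using assms by (intro cross_Un_left) auto

lemma cross_insert_right:
  assumes "finite A" "finite Z" "v \<notin> Z"
  shows "cross A (insert v Z) = cross A {v} + cross A Z"
  unfolding insert_is_Un[of v Z] using assms by (intro cross_Un_right) auto

text \<open>Two letters above all others are distributed in four ways. They form an inversion with
  each other only if \<open>v\<close> stands in front and \<open>u\<close> behind, so exchanging
  them in a mixed distribution changes the parity.\<close>

lemma cross_two_largest: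
  assumes fin: "finite B" "finite Z" and less: "\<And>w. w \<in> B \<union> Z \<Longrightarrow> w < u" "u < v"
  shows "cross (insert v (insert u B)) Z = card Z + (card Z + cross B Z)"
    and "cross (insert u B) (insert v Z) = card Z + cross B Z"
    and "cross (insert v B) (insert u Z) = Suc (card Z + cross B Z)"
    and "cross B (insert v (insert u Z)) = cross B Z"
proof -
  have "u \<notin> B" "u \<notin> Z" "v \<notin> B" "v \<notin> Z" "v \<noteq> u"
    using less by fastforce+
  moreover have "cross {u} Z = card Z" "cross {v} Z = card Z" "cross {v} {u} = 1"
    using cross_eq_mult[of "{u}" Z] cross_eq_mult[of "{v}" Z] cross_eq_mult[of "{v}" "{u}"]
      less less_trans[OF less(1) less(2)] by simp_all
  moreover have "cross {u} {v} = 0" "cross B {u} = 0" "cross B {v} = 0"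
    using less less_trans[OF less(1) less(2)] by (auto intro!: cross_eq_0 less_imp_le)
  ultimately show "cross (insert v (insert u B)) Z = card Z + (card Z + cross B Z)"
    "cross (insert u B) (insert v Z) = card Z + cross B Z"
    "cross (insert v B) (insert u Z) = Suc (card Z + cross B Z)"
    "cross B (insert v (insert u Z)) = cross B Z"
    using fin cross_insert_left[of "insert u B" Z v] cross_insert_left[of B _ u]
      cross_insert_left[of B _ v] cross_insert_right[of _ Z v] cross_insert_right[of _ Z u]
      cross_insert_right[of _ "insert u Z" v]
    by simp_all
qed

lemma sum_Pow_insert:
  assumes "finite A" "u \<notin> A"
  shows "(\<Sum>Z\<in>Pow (insert u A). f Z) = (\<Sum>Z\<in>Pow A. f Z + f (insert u Z))"
proof -
  have "inj_on (insert u) (Pow A)" using assms(2) by (fastforce simp: inj_on_def)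
  moreover have "Pow A \<inter> insert u ` Pow A = {}" using assms(2) by auto
  ultimately show ?thesis
    using assms(1) by (simp add: Pow_insert sum.union_disjoint sum.reindex sum.distrib)
qed

text \<open>If a subset contains exactly one of the two largest elements of \<open>A\<close>, exchanging them reverses the sign.\<close>

lemma signed_sum_subsets:
  fixes g :: "nat \<Rightarrow> 'a::comm_ring_1"
  assumes "finite A" and g: "\<And>m. g (Suc (Suc m)) + g m = d * g m"
  shows "(\<Sum>Z\<in>Pow A. (-1) ^ cross (A - Z) Z * g (card (A - Z))) =
    d ^ (card A div 2) * (\<Sum>e\<le>card A mod 2. g e)"
  using assms(1)
proof (induct "card A" arbitrary: A rule: less_induct)
  case less
  consider "card A = 0" | "card A = 1" | "2 \<le> card A" by linarith
  then show ?case
  proof cases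
    case 1
    then have "A = {}" using less.prems by simp
    then show ?thesis by simp
  next
    case 2
    then obtain u where "A = {u}" by (auto simp: card_Suc_eq numeral_eq_Suc)
    then show ?thesis by (simp add: sum_Pow_insert cross_eq_0 add.commute)
  next
    case 3
    define v where "v = Max A"
    define u where "u = Max (A - {v})"
    define A' where "A' = A - {v} - {u}"
    have "A \<noteq> {}" using 3 by auto
    have v: "v \<in> A" "\<And>w. w \<in> A \<Longrightarrow> w \<le> v"
      using less.prems \<open>A \<noteq> {}\<close> by (auto simp: v_def)
    then have "card (A - {v}) \<ge> 1" using 3 less.prems by simp
    then have "A - {v} \<noteq> {}" by (metis card.empty not_one_le_zero)
    then have uA: "u \<in> A" "u \<noteq> v"
      using Max_in[of "A - {v}"] less.prems by (simp_all add: u_def)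
    have "w \<le> u" if "w \<in> A'" for w
      using Max_ge[of "A - {v}" w] less.prems that by (simp add: u_def A'_def)
    then have u: "u < v" "\<And>w. w \<in> A' \<Longrightarrow> w < u"
      using uA v(2)[of u] by (simp_all add: A'_def order_less_le)
    have A: "A = insert v (insert u A')" "u \<notin> A'" "v \<notin> insert u A'" "finite A'"
      using uA v(1) less.prems unfolding A'_def by blast+
    have card_A: "card A = Suc (Suc (card A'))" using A by simp
    let ?f = "\<lambda>A Z. (-1) ^ cross (A - Z) Z * g (card (A - Z))"
    \<comment> \<open>The two mixed distributions of \<open>u\<close> and \<open>v\<close> cancel;
      the other two combine by the hypothesis on \<open>g\<close>.\<close>
    have four: "?f A Z + ?f A (insert v Z) + (?f A (insert u Z) + ?f A (insert v (insert u Z))) =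
        d * ?f A' Z" if Z: "Z \<in> Pow A'" for Z
    proof -
      have fin: "finite (A' - Z)" "finite Z" using A Z finite_subset by auto
      have out: "u \<notin> A' - Z" "v \<notin> A' - Z" "v \<noteq> u" "v \<notin> Z" "u \<notin> Z" using Z A by auto
      have "A - Z = insert v (insert u (A' - Z))" "A - insert v Z = insert u (A' - Z)"
          "A - insert u Z = insert v (A' - Z)" "A - insert v (insert u Z) = A' - Z"
        unfolding A(1) using out Z A(2,3) by blast+
      moreover have "w < u" if "w \<in> (A' - Z) \<union> Z" for w
        using that u(2) Z by auto
      ultimately have "?f A Z = (-1) ^ cross (A' - Z) Z * g (Suc (Suc (card (A' - Z))))"
          "?f A (insert v Z) = (-1) ^ (card Z + cross (A' - Z) Z) * g (Suc (card (A' - Z)))"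
          "?f A (insert u Z) = - ((-1) ^ (card Z + cross (A' - Z) Z)) * g (Suc (card (A' - Z)))"
          "?f A (insert v (insert u Z)) = ?f A' Z"
        using fin out cross_two_largest[of "A' - Z" Z u v] u(1) by (simp_all add: power_add)
      then show ?thesis
        using g[of "card (A' - Z)"] by (simp flip: distrib_left add: add.commute mult.left_commute[of d])
    qed
    have "(\<Sum>Z\<in>Pow A. ?f A Z) = (\<Sum>Z\<in>Pow (insert v (insert u A')). ?f A Z)"
      by (simp only: A(1)[symmetric])
    also have "\<dots> = (\<Sum>Z\<in>Pow (insert u A'). ?f A Z + ?f A (insert v Z))"
      by (rule sum_Pow_insert) (use A in simp_all)
    also have "\<dots> = (\<Sum>Z\<in>Pow A'. ?f A Z + ?f A (insert v Z) +
        (?f A (insert u Z) + ?f A (insert v (insert u Z))))"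
      by (rule sum_Pow_insert) (use A in simp_all)
    also have "\<dots> = (\<Sum>Z\<in>Pow A'. d * ?f A' Z)"
      by (rule sum.cong[OF refl four])
    also have "\<dots> = d * (d ^ (card A' div 2) * (\<Sum>e\<le>card A' mod 2. g e))"
      using less.hyps[of A'] A(4) card_A by (simp add: sum_distrib_left[symmetric])
    finally show ?thesis by (simp add: card_A)
  qed
qed

text \<open>A finite chain has exactly one final segment of each size. In the induction, a final
  segment of \<open>insert b A\<close> is empty or contains the new maximum
  \<open>b\<close>.\<close>

lemma sum_final_segments:
  fixes A :: "nat set"
  assumes "finite A"
  shows "(\<Sum>Z | Z \<subseteq> A \<and> (\<forall>u\<in>A - Z. \<forall>z\<in>Z. u < z). g (card (A - Z))) = (\<Sum>i\<le>card A. g i)"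
  using assms
proof (induct A rule: finite_linorder_max_induct)
  case empty
  have "{Z. Z = ({} :: nat set)} = {{}}" by auto
  then show ?case by simp
next
  case (insert b A)
  let ?T = "\<lambda>A. {Z. Z \<subseteq> A \<and> (\<forall>u\<in>A - Z. \<forall>z\<in>Z. u < z)}"
  have b: "b \<notin> A" using insert by auto
  have fin: "finite (?T A)" using insert by (auto intro: finite_subset[of _ "Pow A"])
  have "?T (insert b A) = insert {} (insert b ` ?T A)"
  proof (intro set_eqI iffI)
    fix Z assume Z: "Z \<in> ?T (insert b A)"
    show "Z \<in> insert {} (insert b ` ?T A)"
    proof (cases "b \<in> Z")
      case True
      then have "Z = insert b (Z - {b})" "Z - {b} \<in> ?T A" using Z b by blast+
      then show ?thesis by blast
    next
      case False
      then have "z < b \<and> b < z" if "z \<in> Z" for z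
        using Z insert(2) that by blast
      then have "Z = {}" by (meson all_not_in_conv less_asym)
      then show ?thesis by simp
    qed
  qed (use insert(2) in auto)
  moreover have "inj_on (insert b) (?T A)" using b by (fastforce simp: inj_on_def)
  moreover have "{} \<notin> insert b ` ?T A" by auto
  moreover have "card (insert b A - insert b Z) = card (A - Z)" for Z
    using b by (metis Diff_insert2 Diff_insert_absorb insert_Diff_if insertI1)
  ultimately show ?case
    using insert b fin by (simp add: sum.reindex add.commute)
qed

text \<open>Filtering states the order of the block for any set \<open>S\<close>, so the condition
  survives the removal of letters in the recursion.\<close>

definition arrangements :: "nat \<Rightarrow> nat \<Rightarrow> nat set \<Rightarrow> nat list set" where
  "arrangements a c S = {\<sigma>. distinct \<sigma> \<and> set \<sigma> = S \<and> sorted (filter (\<lambda>s. s \<in> {a..c}) \<sigma>)}"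

definition signed_gf :: "'a::field \<Rightarrow> nat \<Rightarrow> nat \<Rightarrow> nat set \<Rightarrow> 'a" where
  "signed_gf x a c S = (\<Sum>\<sigma>\<in>arrangements a c S. (-1) ^ inv_num \<sigma> * word_gf x \<sigma>)"

text \<open>The sets on which a word that decreases weakly on \<open>{a..c}\<close> can vanish.\<close>

definition zero_sets :: "nat \<Rightarrow> nat \<Rightarrow> nat set \<Rightarrow> nat set set" where
  "zero_sets a c S = {Z. Z \<subseteq> S \<and> (\<forall>u\<in>S - Z. \<forall>z\<in>Z. u \<in> {a..c} \<longrightarrow> z \<in> {a..c} \<longrightarrow> u < z)}"

lemma finite_arrangements: "finite S \<Longrightarrow> finite (arrangements a c S)"
  by (rule finite_subset[OF _ finite_subset_distinct[of S]]) (auto simp: arrangements_def)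

lemma finite_zero_sets: "finite S \<Longrightarrow> finite (zero_sets a c S)"
  by (rule finite_subset[of _ "Pow S"]) (auto simp: zero_sets_def)

text \<open>\<open>word_gf_rec\<close> is applied to every arrangement. An arrangement cut before an
  increasing suffix amounts to a zero set \<open>Z\<close> and an arrangement of
  \<open>S - Z\<close>, since such a suffix is determined by its set; the sign splits by
  \<open>inv_num_append_sorted\<close>.\<close>

lemma signed_gf_rec:
  fixes x :: "'a::field"
  assumes nz: "\<And>m. m \<ge> 1 \<Longrightarrow> x ^ m \<noteq> 1" and S: "finite S"
  shows "signed_gf x a c S =
    (\<Sum>Z\<in>zero_sets a c S. (-1) ^ cross (S - Z) Z * x ^ card (S - Z) * signed_gf x a c (S - Z))"
proof -
  let ?I = "\<lambda>\<sigma>. {i. i \<le> length \<sigma> \<and> sorted (drop i \<sigma>)}"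
  let ?A = "Sigma (arrangements a c S) ?I"
  let ?B = "Sigma (zero_sets a c S) (\<lambda>Z. arrangements a c (S - Z))"
  have split: "set (take i \<sigma>) = S - set (drop i \<sigma>)" "set (drop i \<sigma>) \<in> zero_sets a c S"
      "take i \<sigma> \<in> arrangements a c (S - set (drop i \<sigma>))"
      "sorted_list_of_set (set (drop i \<sigma>)) = drop i \<sigma>"
    if "(\<sigma>, i) \<in> ?A" for \<sigma> i
  proof -
    define \<tau> \<rho> where "\<tau> = take i \<sigma>" and "\<rho> = drop i \<sigma>"
    have "distinct (\<tau> @ \<rho>)" "set (\<tau> @ \<rho>) = S" "sorted \<rho>"
        "sorted (filter (\<lambda>s. s \<in> {a..c}) (\<tau> @ \<rho>))"
      using that by (auto simp: \<tau>_def \<rho>_def arrangements_def simp del: filter_append set_append)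
    then show "set (take i \<sigma>) = S - set (drop i \<sigma>)" "set (drop i \<sigma>) \<in> zero_sets a c S"
      "take i \<sigma> \<in> arrangements a c (S - set (drop i \<sigma>))"
      "sorted_list_of_set (set (drop i \<sigma>)) = drop i \<sigma>"
      unfolding \<tau>_def[symmetric] \<rho>_def[symmetric]
      by (auto simp: zero_sets_def arrangements_def sorted_append order_less_le
          sorted_list_of_set.idem_if_sorted_distinct)
  qed
  have join: "\<tau> @ sorted_list_of_set Z \<in> arrangements a c S" "length \<tau> = card (S - Z)" "finite Z"
    if "(Z, \<tau>) \<in> ?B" for Z \<tau>
  proof -
    have *: "distinct \<tau>" "set \<tau> = S - Z" "Z \<subseteq> S" "sorted (filter (\<lambda>s. s \<in> {a..c}) \<tau>)"
        "\<forall>u\<in>S - Z. \<forall>z\<in>Z. u \<in> {a..c} \<longrightarrow> z \<in> {a..c} \<longrightarrow> u < z"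
      using that by (auto simp: zero_sets_def arrangements_def)
    show "finite Z" using * S finite_subset by blast
    show "length \<tau> = card (S - Z)" using * distinct_card by metis
    have "sorted (filter (\<lambda>s. s \<in> {a..c}) (sorted_list_of_set Z))"
      by (intro sorted_wrt_filter) simp
    then show "\<tau> @ sorted_list_of_set Z \<in> arrangements a c S"
      using * \<open>finite Z\<close> by (auto simp: arrangements_def sorted_append intro: less_imp_le)
  qed
  have "signed_gf x a c S = (\<Sum>\<sigma>\<in>arrangements a c S. \<Sum>i\<in>?I \<sigma>.
      (-1) ^ inv_num \<sigma> * (x ^ i * word_gf x (take i \<sigma>)))"
    unfolding signed_gf_def sum_distrib_left[symmetric]
    by (rule sum.cong[OF refl], rule arg_cong[OF word_gf_rec[OF nz]])
  also have "\<dots> = (\<Sum>(\<sigma>, i)\<in>?A. (-1) ^ inv_num \<sigma> * (x ^ i * word_gf x (take i \<sigma>)))"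
    using finite_arrangements[OF S] by (intro sum.Sigma) (auto intro: finite_subset[of _ "{..length _}"])
  also have "\<dots> = (\<Sum>(Z, \<tau>)\<in>?B. (-1) ^ cross (S - Z) Z * x ^ card (S - Z) *
      ((-1) ^ inv_num \<tau> * word_gf x \<tau>))"
  proof (rule sum.reindex_bij_witness[of _ "\<lambda>(Z, \<tau>). (\<tau> @ sorted_list_of_set Z, length \<tau>)"
        "\<lambda>(\<sigma>, i). (set (drop i \<sigma>), take i \<sigma>)"])
    fix p assume p: "p \<in> ?A"
    then obtain \<sigma> i where \<sigma>: "p = (\<sigma>, i)" "\<sigma> \<in> arrangements a c S" "i \<le> length \<sigma>" "sorted (drop i \<sigma>)"
      by auto
    note split = split[OF p[unfolded \<sigma>(1)]]
    have "card (S - set (drop i \<sigma>)) = i"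
      using split(1) \<sigma> distinct_card[of "take i \<sigma>"] by (simp add: arrangements_def)
    moreover have "inv_num \<sigma> = inv_num (take i \<sigma>) + cross (S - set (drop i \<sigma>)) (set (drop i \<sigma>))"
      using inv_num_append_sorted[of "take i \<sigma>" "drop i \<sigma>"] \<sigma> split(1)
      by (simp add: arrangements_def)
    ultimately show "(case case p of (\<sigma>, i) \<Rightarrow> (set (drop i \<sigma>), take i \<sigma>) of (Z, \<tau>) \<Rightarrow>
        (-1) ^ cross (S - Z) Z * x ^ card (S - Z) * ((-1) ^ inv_num \<tau> * word_gf x \<tau>)) =
        (case p of (\<sigma>, i) \<Rightarrow> (-1) ^ inv_num \<sigma> * (x ^ i * word_gf x (take i \<sigma>)))"
      by (simp add: \<sigma>(1) power_add)
    show "(case case p of (\<sigma>, i) \<Rightarrow> (set (drop i \<sigma>), take i \<sigma>) of (Z, \<tau>) \<Rightarrow>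
        (\<tau> @ sorted_list_of_set Z, length \<tau>)) = p"
      using split \<sigma> by simp
    show "(case p of (\<sigma>, i) \<Rightarrow> (set (drop i \<sigma>), take i \<sigma>)) \<in> ?B"
      using split \<sigma> by simp
  next
    fix p assume p: "p \<in> ?B"
    then obtain Z \<tau> where \<tau>: "p = (Z, \<tau>)" by (cases p)
    note join = join[OF p[unfolded \<tau>]]
    show "(case case p of (Z, \<tau>) \<Rightarrow> (\<tau> @ sorted_list_of_set Z, length \<tau>) of (\<sigma>, i) \<Rightarrow>
        (set (drop i \<sigma>), take i \<sigma>)) = p"
      using join \<tau> by simp
    show "(case p of (Z, \<tau>) \<Rightarrow> (\<tau> @ sorted_list_of_set Z, length \<tau>)) \<in> ?A"
      using join \<tau> by simp
  qed
  also have "\<dots> = (\<Sum>Z\<in>zero_sets a c S. \<Sum>\<tau>\<in>arrangements a c (S - Z).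
      (-1) ^ cross (S - Z) Z * x ^ card (S - Z) * ((-1) ^ inv_num \<tau> * word_gf x \<tau>))"
    using S finite_zero_sets finite_arrangements by (intro sum.Sigma[symmetric]) auto
  finally show ?thesis
    by (simp add: signed_gf_def sum_distrib_left)
qed

section \<open>Solving the recursion\<close>

text \<open>There are \<open>L\<close> letters below the block, \<open>k\<close> in it and \<open>R\<close> above it. The four parity
  cases come from summing the geometric series in the letters outside the block explicitly; pairs of
  letters on the same side only contribute \<open>1 / (1 - x\<^sup>2)\<close>.\<close>

definition block_gf :: "'a::field \<Rightarrow> nat \<Rightarrow> nat \<Rightarrow> nat \<Rightarrow> 'a" where
  "block_gf x L k R =
     (if even L \<and> even R then 1 / qpoch x k
      else if odd k then 1 / (qpoch x k * (if odd L \<and> odd R then 1 - x\<^sup>2 else 1 + x))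
      else if even R then (1 + x ^ Suc k) / (qpoch x (Suc k) * (1 + x))
      else if even L then (1 + 2 * x - x ^ Suc k) / (qpoch x (Suc k) * (1 + x))
      else (1 - 2 * x + x ^ Suc k) / (qpoch x (Suc k) * (1 - x\<^sup>2)))
     / (1 - x\<^sup>2) ^ (L div 2 + R div 2)"

text \<open>The term of the recursion in which \<open>L'\<close>, \<open>k'\<close>, \<open>R'\<close> letters stay nonzero. The sign counts the
  pairs from different parts modulo 2, whence \<open>L + L'\<close> in place of \<open>L - L'\<close>.\<close>

definition shifted_gf :: "'a::field \<Rightarrow> nat \<Rightarrow> nat \<Rightarrow> nat \<Rightarrow> nat \<Rightarrow> nat \<Rightarrow> 'a" where
  "shifted_gf x L k L' k' R' =
     (-1) ^ ((k' + R') * (L + L') + R' * (k + k')) * x ^ (L' + k' + R') * block_gf x L' k' R'"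

context
  fixes x :: "'a::field"
  assumes nz: "\<And>m. m \<ge> 1 \<Longrightarrow> x ^ m \<noteq> 1"
begin

text \<open>The denominators of \<open>block_gf\<close>, with \<open>1 - x * x ^ k\<close> in the
  form to which \<open>power_Suc\<close> rewrites \<open>1 - x ^ Suc k\<close>.\<close>

lemma nonzeros: "1 + x \<noteq> 0" "1 - x \<noteq> 0" "1 - x\<^sup>2 \<noteq> 0" "1 - x * x ^ k \<noteq> 0" "qpoch x k \<noteq> 0"
proof -
  show *: "1 - x \<noteq> 0" "1 - x\<^sup>2 \<noteq> 0" "1 - x * x ^ k \<noteq> 0" "qpoch x k \<noteq> 0"
    using nz[of 1] nz[of 2] nz[of "Suc k"] qpoch_nonzero[OF nz] by auto
  have "1 - x\<^sup>2 = (1 + x) * (1 - x)" by (simp add: power2_eq_square algebra_simps)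
  then show "1 + x \<noteq> 0" using * by auto
qed

lemma one_minus_square: "1 - x\<^sup>2 = (1 - x) * (1 + x)"
  by (simp add: power2_eq_square algebra_simps)

lemma block_gf_0:
  "block_gf x 0 0 0 = 1" "block_gf x (Suc 0) 0 0 = 1 / (1 - x)" "block_gf x 0 0 (Suc 0) = 1 / (1 - x)"
  "block_gf x (Suc 0) 0 (Suc 0) = 1 / (1 - x\<^sup>2)"
proof -
  have "(1 + x) / ((1 - x) * (1 + x)) = 1 / (1 - x)" using nonzeros(1) by simp
  moreover have "(1 + 2 * x - x) / ((1 - x) * (1 + x)) = 1 / (1 - x)"
    using nonzeros(1) by (simp add: add.commute[of x 1])
  moreover have "(1 - 2 * x + x) / ((1 - x) * (1 - x\<^sup>2)) = 1 / (1 - x\<^sup>2)" using nonzeros(2) by simp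
  ultimately show "block_gf x 0 0 0 = 1" "block_gf x (Suc 0) 0 0 = 1 / (1 - x)"
    "block_gf x 0 0 (Suc 0) = 1 / (1 - x)" "block_gf x (Suc 0) 0 (Suc 0) = 1 / (1 - x\<^sup>2)"
    by (simp_all add: block_gf_def qpoch_Suc)
qed

text \<open>For a fixed parity of \<open>k\<close> all values are rational functions of
  \<open>x\<close>, \<open>X\<close> and \<open>P\<close>, which turns the inductive steps below
  into identities within reach of \<open>algebra\<close>.\<close>

lemma block_gf_even:
  assumes "even k"
  defines "X \<equiv> x ^ k" and "P \<equiv> qpoch x k"
  shows "block_gf x 0 k 0 = 1 / P" "block_gf x 0 (Suc k) 0 = 1 / (P * (1 - x * X))"
    "block_gf x (Suc 0) k 0 = (1 + x * X) / (P * (1 - x * X) * (1 + x))"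
    "block_gf x (Suc 0) (Suc k) 0 = 1 / (P * (1 - x * X) * (1 + x))"
    "block_gf x 0 k (Suc 0) = (1 + 2 * x - x * X) / (P * (1 - x * X) * (1 + x))"
    "block_gf x 0 (Suc k) (Suc 0) = 1 / (P * (1 - x * X) * (1 + x))"
    "block_gf x (Suc 0) k (Suc 0) = (1 - 2 * x + x * X) / (P * (1 - x * X) * ((1 - x) * (1 + x)))"
    "block_gf x (Suc 0) (Suc k) (Suc 0) = 1 / (P * (1 - x * X) * ((1 - x) * (1 + x)))"
  using assms(1) one_minus_square by (simp_all add: block_gf_def qpoch_Suc X_def P_def)

lemma block_gf_odd:
  assumes "odd k"
  defines "X \<equiv> x ^ k" and "P \<equiv> qpoch x k"
  shows "block_gf x 0 k 0 = 1 / P" "block_gf x 0 (Suc k) 0 = 1 / (P * (1 - x * X))"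
    "block_gf x (Suc 0) k 0 = 1 / (P * (1 + x))"
    "block_gf x (Suc 0) (Suc k) 0 = (1 + x * (x * X)) / (P * (1 - x * X) * (1 - x * (x * X)) * (1 + x))"
    "block_gf x 0 k (Suc 0) = 1 / (P * (1 + x))"
    "block_gf x 0 (Suc k) (Suc 0) =
      (1 + 2 * x - x * (x * X)) / (P * (1 - x * X) * (1 - x * (x * X)) * (1 + x))"
    "block_gf x (Suc 0) k (Suc 0) = 1 / (P * ((1 - x) * (1 + x)))"
    "block_gf x (Suc 0) (Suc k) (Suc 0) =
      (1 - 2 * x + x * (x * X)) / (P * (1 - x * X) * (1 - x * (x * X)) * ((1 - x) * (1 + x)))"
  using assms(1) one_minus_square by (simp_all add: block_gf_def qpoch_Suc X_def P_def)
lemma block_gf_Suc_Suc: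
  "block_gf x (Suc (Suc L)) k R = block_gf x L k R / (1 - x\<^sup>2)"
  "block_gf x L k (Suc (Suc R)) = block_gf x L k R / (1 - x\<^sup>2)"
  by (simp_all add: block_gf_def)

text \<open>For a block alone no signs occur and the sum telescopes:
  \<open>x ^ Suc k / qpoch x (Suc k)\<close> is the difference of \<open>1 / qpoch x (Suc k)\<close>
  and \<open>1 / qpoch x k\<close>.\<close>

lemma sum_block_gf_00: "(\<Sum>i\<le>k. x ^ i * block_gf x 0 i 0) = block_gf x 0 k 0"
proof (induct k)
  case (Suc k)
  then show ?case
    using nonzeros(4,5)[of k] by (simp add: block_gf_def qpoch_Suc field_simps)
qed (simp add: block_gf_def)

text \<open>One letter below the block. If it stays nonzero there is no sign; if it vanishes, the
  \<open>i\<close> nonzero letters of the block are larger and come before it, which gives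
  \<open>(-1) ^ i\<close>.\<close>

lemma sum_block_gf_10:
  "(\<Sum>i\<le>k. x ^ Suc i * block_gf x 1 i 0 + (-1) ^ i * x ^ i * block_gf x 0 i 0) = block_gf x 1 k 0"
proof (induct k)
  case 0
  show ?case using nonzeros(2) by (simp add: block_gf_0 field_simps)
next
  case (Suc k)
  define X P where "X = x ^ k" and "P = qpoch x k"
  have n: "1 - x * X \<noteq> 0" "1 - x * (x * X) \<noteq> 0" "P \<noteq> 0" "1 + x \<noteq> 0" "1 - x \<noteq> 0"
    using nonzeros(1,2) nonzeros(4)[of k] nonzeros(4)[of "Suc k"] nonzeros(5)[of k]
    by (simp_all add: X_def P_def)
  have "block_gf x 1 (Suc k) 0 - block_gf x 1 k 0 =
      x ^ Suc (Suc k) * block_gf x 1 (Suc k) 0 + (-1) ^ Suc k * x ^ Suc k * block_gf x 0 (Suc k) 0"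
  proof (cases "even k")
    case True
    have sign: "(-1 :: 'a) ^ k = 1" using True by simp
    show ?thesis
      unfolding One_nat_def block_gf_even[OF True] power_Suc sign X_def[symmetric] P_def[symmetric]
      using n by (simp add: divide_simps) algebra
  next
    case False
    have sign: "(-1 :: 'a) ^ k = - 1" using False by simp
    show ?thesis
      unfolding One_nat_def block_gf_odd[OF False] power_Suc sign X_def[symmetric] P_def[symmetric]
      using n by (simp add: divide_simps) algebra
  qed
  then show ?case using Suc by (simp add: algebra_simps)
qed

text \<open>The sign involves the upper limit, so a new term flips all earlier ones.\<close>

lemma alternating_sum_Suc:
  "(\<Sum>i\<le>Suc k. (-1) ^ (Suc k + i) * f i) = f (Suc k) - (\<Sum>i\<le>k. (-1) ^ (k + i) * (f i :: 'a))"
proof -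
  have "(-1 :: 'a) ^ (Suc k + Suc k) = 1" by (simp only: minus_one_power_iff) simp
  then show ?thesis
    unfolding sum.atMost_Suc by (simp add: sum_negf)
qed

text \<open>One letter above the block. If it stays nonzero it precedes the \<open>k - i\<close>
  vanishing letters of the block, whence \<open>(-1) ^ (k + i)\<close>. The terms in which it
  vanishes add up to \<open>block_gf x 0 k 0\<close> by \<open>sum_block_gf_00\<close>.\<close>

lemma sum_block_gf_01:
  "(\<Sum>i\<le>k. (-1) ^ (k + i) * (x ^ Suc i * block_gf x 0 i 1)) + block_gf x 0 k 0 = block_gf x 0 k 1"
proof (induct k)
  case 0
  show ?case using nonzeros(2) by (simp add: block_gf_0 field_simps)
next
  case (Suc k)
  define X P where "X = x ^ k" and "P = qpoch x k"
  have n: "1 - x * X \<noteq> 0" "1 - x * (x * X) \<noteq> 0" "P \<noteq> 0" "1 + x \<noteq> 0" "1 - x \<noteq> 0"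
    using nonzeros(1,2) nonzeros(4)[of k] nonzeros(4)[of "Suc k"] nonzeros(5)[of k]
    by (simp_all add: X_def P_def)
  have step: "block_gf x 0 (Suc k) 1 - block_gf x 0 (Suc k) 0 =
      block_gf x 0 k 0 - block_gf x 0 k 1 + x ^ Suc (Suc k) * block_gf x 0 (Suc k) 1"
  proof (cases "even k")
    case True
    have sign: "(-1 :: 'a) ^ k = 1" using True by simp
    show ?thesis
      unfolding One_nat_def block_gf_even[OF True] power_Suc sign X_def[symmetric] P_def[symmetric]
      using n by (simp add: divide_simps) algebra
  next
    case False
    have sign: "(-1 :: 'a) ^ k = - 1" using False by simp
    show ?thesis
      unfolding One_nat_def block_gf_odd[OF False] power_Suc sign X_def[symmetric] P_def[symmetric]
      using n by (simp add: divide_simps) algebra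
  qed
  have U: "(\<Sum>i\<le>k. (-1) ^ (k + i) * (x ^ Suc i * block_gf x 0 i 1)) =
      block_gf x 0 k 1 - block_gf x 0 k 0"
    using Suc by (simp only: eq_diff_eq)
  show ?case unfolding alternating_sum_Suc U using step by (simp add: algebra_simps)
qed

text \<open>One letter on each side. While the upper letter stays nonzero, a vanishing lower letter
  is preceded by it and by \<open>i\<close> letters of the block, hence the factor
  \<open>- (-1) ^ i\<close>. The terms in which the upper letter vanishes add up to
  \<open>block_gf x 1 k 0\<close> by \<open>sum_block_gf_10\<close>.\<close>

lemma sum_block_gf_11:
  "(\<Sum>i\<le>k. (-1) ^ (k + i) * (x ^ Suc (Suc i) * block_gf x 1 i 1 - (-1) ^ i * x ^ Suc i * block_gf x 0 i 1))
    + block_gf x 1 k 0 = block_gf x 1 k 1"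
proof (induct k)
  case 0
  have "x / (1 - x) = 1 / (1 - x) - 1" "x\<^sup>2 / (1 - x\<^sup>2) = 1 / (1 - x\<^sup>2) - 1"
    using nonzeros(2,3) by (simp_all add: field_simps)
  then show ?case by (simp add: block_gf_0 power2_eq_square)
next
  case (Suc k)
  define X P where "X = x ^ k" and "P = qpoch x k"
  have n: "1 - x * X \<noteq> 0" "1 - x * (x * X) \<noteq> 0" "P \<noteq> 0" "1 + x \<noteq> 0" "1 - x \<noteq> 0"
    using nonzeros(1,2) nonzeros(4)[of k] nonzeros(4)[of "Suc k"] nonzeros(5)[of k]
    by (simp_all add: X_def P_def)
  have step: "block_gf x 1 (Suc k) 1 - block_gf x 1 (Suc k) 0 =
      block_gf x 1 k 0 - block_gf x 1 k 1 + x ^ Suc (Suc (Suc k)) * block_gf x 1 (Suc k) 1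
        - (-1) ^ Suc k * x ^ Suc (Suc k) * block_gf x 0 (Suc k) 1"
  proof (cases "even k")
    case True
    have sign: "(-1 :: 'a) ^ k = 1" using True by simp
    show ?thesis
      unfolding One_nat_def block_gf_even[OF True] power_Suc sign X_def[symmetric] P_def[symmetric]
      using n by (simp add: divide_simps) algebra
  next
    case False
    have sign: "(-1 :: 'a) ^ k = - 1" using False by simp
    show ?thesis
      unfolding One_nat_def block_gf_odd[OF False] power_Suc sign X_def[symmetric] P_def[symmetric]
      using n by (simp add: divide_simps) algebra
  qed
  have U: "(\<Sum>i\<le>k. (-1) ^ (k + i) *
      (x ^ Suc (Suc i) * block_gf x 1 i 1 - (-1) ^ i * x ^ Suc i * block_gf x 0 i 1)) =
      block_gf x 1 k 1 - block_gf x 1 k 0"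
    using Suc by (simp only: eq_diff_eq)
  show ?case unfolding alternating_sum_Suc U using step by (simp add: algebra_simps)
qed

lemma geometric_pair: "x\<^sup>2 * w / (1 - x\<^sup>2) + w = w / (1 - x\<^sup>2)"
  using nonzeros(3) by (simp add: field_simps)

text \<open>The hypothesis of \<open>signed_sum_subsets\<close> with
  \<open>d = 1 / (1 - x ^ 2)\<close>: two more nonzero letters leave the sign alone and bring the
  factor \<open>x ^ 2 / (1 - x ^ 2)\<close>.\<close>

lemma shifted_gf_left:
  "shifted_gf x L k (Suc (Suc L')) k' R' + shifted_gf x L k L' k' R' =
    1 / (1 - x\<^sup>2) * shifted_gf x L k L' k' R'"
proof -
  have "(-1 :: 'a) ^ ((k' + R') * (L + Suc (Suc L')) + R' * (k + k')) =
      (-1) ^ ((k' + R') * (L + L') + R' * (k + k'))"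
    unfolding minus_one_power_iff by (rule if_cong) auto
  then have "shifted_gf x L k (Suc (Suc L')) k' R' = x\<^sup>2 * shifted_gf x L k L' k' R' / (1 - x\<^sup>2)"
    by (simp add: shifted_gf_def block_gf_Suc_Suc power2_eq_square)
  then show ?thesis using geometric_pair by simp
qed

lemma shifted_gf_right:
  "shifted_gf x L k L' k' (Suc (Suc R')) + shifted_gf x L k L' k' R' =
    1 / (1 - x\<^sup>2) * shifted_gf x L k L' k' R'"
proof -
  have "(-1 :: 'a) ^ ((k' + Suc (Suc R')) * (L + L') + Suc (Suc R') * (k + k')) =
      (-1) ^ ((k' + R') * (L + L') + R' * (k + k'))"
    unfolding minus_one_power_iff by (rule if_cong) auto
  then have "shifted_gf x L k L' k' (Suc (Suc R')) = x\<^sup>2 * shifted_gf x L k L' k' R' / (1 - x\<^sup>2)"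
    by (simp add: shifted_gf_def block_gf_Suc_Suc power2_eq_square)
  then show ?thesis using geometric_pair by simp
qed

text \<open>The four parity cases are the four sums above, since \<open>shifted_gf\<close> depends
  on \<open>L\<close> only through its parity.\<close>

lemma sum_shifted_gf:
  "(\<Sum>k'\<le>k. \<Sum>e\<le>L mod 2. \<Sum>e'\<le>R mod 2. shifted_gf x L k e k' e') = block_gf x (L mod 2) k (R mod 2)"
proof -
  consider "even L" "even R" | "odd L" "even R" | "even L" "odd R" | "odd L" "odd R" by blast
  then show ?thesis
  proof cases
    case 1
    then show ?thesis using sum_block_gf_00 by (simp add: shifted_gf_def)
  next
    case 2
    then have "L mod 2 = Suc 0" "R mod 2 = 0" by (auto simp: odd_iff_mod_2_eq_one)
    then show ?thesis using sum_block_gf_10 2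
      by (simp add: shifted_gf_def minus_one_power_iff add.commute cong: if_cong)
  next
    case 3
    then have "L mod 2 = 0" "R mod 2 = Suc 0" by (auto simp: odd_iff_mod_2_eq_one)
    then show ?thesis using sum_block_gf_01[of k] sum_block_gf_00[of k] 3
      by (simp add: shifted_gf_def minus_one_power_iff sum.distrib add.commute mult.assoc cong: if_cong)
  next
    case 4
    then have *: "L mod 2 = Suc 0" "R mod 2 = Suc 0" by (auto simp: odd_iff_mod_2_eq_one)
    have "(\<Sum>k'\<le>k. \<Sum>e\<le>L mod 2. \<Sum>e'\<le>R mod 2. shifted_gf x L k e k' e') =
      (\<Sum>i\<le>k. (-1) ^ (k + i) * (x ^ Suc (Suc i) * block_gf x 1 i 1 - (-1) ^ i * x ^ Suc i * block_gf x 0 i 1))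
       + (\<Sum>i\<le>k. x ^ Suc i * block_gf x 1 i 0 + (-1) ^ i * x ^ i * block_gf x 0 i 0)"
      unfolding sum.distrib[symmetric] using 4 *
      by (intro sum.cong refl) (auto simp: shifted_gf_def minus_one_power_iff)
    then show ?thesis using sum_block_gf_10[of k] sum_block_gf_11[of k] * by simp
  qed
qed

lemma block_gf_mod: "block_gf x L k R = (1 / (1 - x\<^sup>2)) ^ (L div 2) * (1 / (1 - x\<^sup>2)) ^ (R div 2) *
    block_gf x (L mod 2) k (R mod 2)"
  by (simp add: block_gf_def power_add power_one_over)

end

text \<open>A zero set consists of arbitrary subsets of \<open>A\<close> and \<open>C\<close> and a
  final segment of \<open>B\<close>. By \<open>signed_sum_subsets\<close> at most one letter of
  \<open>A\<close> and of \<open>C\<close> remains, by \<open>sum_final_segments\<close> the sum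
  over the block becomes one over sizes, and \<open>sum_shifted_gf\<close> evaluates the
  rest.\<close>

lemma sum_zero_sets_block_gf:
  fixes x :: "'a::field" and A B C :: "nat set"
  assumes nz: "\<And>m. m \<ge> 1 \<Longrightarrow> x ^ m \<noteq> 1"
    and fin: "finite A" "finite B" "finite C"
    and sub: "A \<subseteq> {..<a}" "B \<subseteq> {a..c}" "C \<subseteq> {c<..}" and "a \<le> Suc c"
  defines "S \<equiv> A \<union> B \<union> C"
  shows "(\<Sum>Z\<in>zero_sets a c S. (-1) ^ cross (S - Z) Z * x ^ card (S - Z) *
      block_gf x (card (A - Z)) (card (B - Z)) (card (C - Z))) =
    block_gf x (card A) (card B) (card C)"
proof -
  let ?T = "{Y. Y \<subseteq> B \<and> (\<forall>u\<in>B - Y. \<forall>z\<in>Y. u < z)}"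
  let ?s = "\<lambda>A Z. (-1 :: 'a) ^ cross (A - Z) Z"
  let ?h = "\<lambda>X Y Z. shifted_gf x (card A) (card B) (card (A - X)) (card (B - Y)) (card (C - Z))"
  have AB: "u < v" if "u \<in> A" "v \<in> B" for u v
    using that sub by fastforce
  have BC: "u < v" if "u \<in> B" "v \<in> C" for u v
    using that sub by fastforce
  have AC: "u < v" if "u \<in> A" "v \<in> C" for u v
    using that sub \<open>a \<le> Suc c\<close> by fastforce
  have disj: "A \<inter> B = {}" "A \<inter> C = {}" "B \<inter> C = {}"
    using sub \<open>a \<le> Suc c\<close> by fastforce+
  have inB: "u \<in> B" if "u \<in> S" "u \<in> {a..c}" for u
  proof -
    have "u \<notin> A" "u \<notin> C" using that(2) sub by fastforce+
    then show ?thesis using that(1) by (simp add: S_def)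
  qed
  have summand: "(-1) ^ cross (S - (X \<union> Y \<union> Z)) (X \<union> Y \<union> Z) * x ^ card (S - (X \<union> Y \<union> Z)) *
      block_gf x (card (A - (X \<union> Y \<union> Z))) (card (B - (X \<union> Y \<union> Z))) (card (C - (X \<union> Y \<union> Z))) =
      ?s A X * (?s C Z * ?h X Y Z)"
    if X: "X \<in> Pow A" and Y: "Y \<in> ?T" and Z: "Z \<in> Pow C" for X Y Z
  proof -
    have finX: "finite X" "finite Y" "finite Z" "finite (A - X)" "finite (B - Y)" "finite (C - Z)"
      using X Y Z fin finite_subset by auto
    have dj: "(A - X) \<inter> (B - Y) = {}" "(A - X \<union> (B - Y)) \<inter> (C - Z) = {}"
        "X \<inter> Y = {}" "(X \<union> Y) \<inter> Z = {}"
      using X Y Z disj by auto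
    have diff: "A - (X \<union> Y \<union> Z) = A - X" "B - (X \<union> Y \<union> Z) = B - Y" "C - (X \<union> Y \<union> Z) = C - Z"
        "S - (X \<union> Y \<union> Z) = A - X \<union> (B - Y) \<union> (C - Z)"
      using X Y Z disj unfolding S_def by auto
    have "card (S - (X \<union> Y \<union> Z)) = card (A - X) + card (B - Y) + card (C - Z)"
      unfolding diff using finX dj by (simp add: card_Un_disjoint)
    \<comment> \<open>Every letter of \<open>A\<close> is below every letter of \<open>B\<close>,
      and these are below \<open>C\<close>, so pairs from different parts contribute a product of
      cardinalities or nothing. The final segment \<open>Y\<close> has no inversions with
      \<open>B - Y\<close>.\<close>
    moreover have "cross (S - (X \<union> Y \<union> Z)) (X \<union> Y \<union> Z) = cross (A - X) X + cross (C - Z) Z +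
        (card (B - Y) + card (C - Z)) * card X + card (C - Z) * card Y"
    proof -
      have sub': "X \<subseteq> A" "Y \<subseteq> B" "Z \<subseteq> C" using X Y Z by auto
      have "cross (B - Y) Y = 0" using Y by (intro cross_eq_0) (auto intro: less_imp_le)
      moreover have "cross (A - X) Y = 0" "cross (A - X) Z = 0" "cross (B - Y) Z = 0"
        using AB AC BC sub' by (blast intro: cross_eq_0 less_imp_le)+
      moreover have "cross (B - Y) X = card (B - Y) * card X" "cross (C - Z) X = card (C - Z) * card X"
          "cross (C - Z) Y = card (C - Z) * card Y"
        using AB AC BC sub' by (blast intro: cross_eq_mult)+
      ultimately show ?thesis
        unfolding diff using finX dj
        by (simp add: cross_Un_left cross_Un_right distrib_right)
    qed
    \<comment> \<open>Modulo 2, \<open>card X\<close> may be replaced by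
      \<open>card A + card (A - X)\<close>, and \<open>card Y\<close> likewise; this produces the
      exponent in \<open>shifted_gf\<close>.\<close>
    moreover have "card A = card (A - X) + card X" "card B = card (B - Y) + card Y"
      using X Y fin finX by (auto simp: card_Diff_subset card_mono)
    ultimately have card: "card (S - (X \<union> Y \<union> Z)) = card (A - X) + card (B - Y) + card (C - Z)"
      and "(-1 :: 'a) ^ cross (S - (X \<union> Y \<union> Z)) (X \<union> Y \<union> Z) = (-1) ^ (cross (A - X) X + (cross (C - Z) Z +
        ((card (B - Y) + card (C - Z)) * (card A + card (A - X)) + card (C - Z) * (card B + card (B - Y)))))"
      unfolding minus_one_power_iff by (blast, intro if_cong) auto
    then show ?thesis
      unfolding diff(1-3) shifted_gf_def by (simp add: power_add)
  qed
  have "(\<Sum>Z\<in>zero_sets a c S. (-1) ^ cross (S - Z) Z * x ^ card (S - Z) *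
      block_gf x (card (A - Z)) (card (B - Z)) (card (C - Z))) =
      (\<Sum>(Y, X, Z)\<in>?T \<times> Pow A \<times> Pow C. ?s A X * (?s C Z * ?h X Y Z))"
  proof (rule sum.reindex_bij_witness[of _ "\<lambda>(Y, X, Z). X \<union> Y \<union> Z" "\<lambda>Z. (Z \<inter> B, Z \<inter> A, Z \<inter> C)"])
    fix W assume "W \<in> zero_sets a c S"
    then have W: "W \<subseteq> S" "\<forall>u\<in>S - W. \<forall>z\<in>W. u \<in> {a..c} \<longrightarrow> z \<in> {a..c} \<longrightarrow> u < z"
      by (auto simp: zero_sets_def)
    show eq: "(case (W \<inter> B, W \<inter> A, W \<inter> C) of (Y, X, Z) \<Rightarrow> X \<union> Y \<union> Z) = W"
      using W(1) by (auto simp: S_def)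
    have "W \<inter> B \<in> ?T"
    proof (intro CollectI conjI ballI)
      fix u z assume "u \<in> B - W \<inter> B" "z \<in> W \<inter> B"
      then have "u \<in> S - W" "z \<in> W" "u \<in> {a..c}" "z \<in> {a..c}"
        using sub(2) by (auto simp: S_def)
      then show "u < z" using W(2) by blast
    qed simp
    then show m: "(W \<inter> B, W \<inter> A, W \<inter> C) \<in> ?T \<times> Pow A \<times> Pow C" by simp
    show "(case (W \<inter> B, W \<inter> A, W \<inter> C) of (Y, X, Z) \<Rightarrow> ?s A X * (?s C Z * ?h X Y Z)) =
      (-1) ^ cross (S - W) W * x ^ card (S - W) * block_gf x (card (A - W)) (card (B - W)) (card (C - W))"
      using summand[of "W \<inter> A" "W \<inter> B" "W \<inter> C"] m eq by simp
  next
    fix p assume "p \<in> ?T \<times> Pow A \<times> Pow C"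
    then obtain X Y Z where p: "p = (Y, X, Z)" "Y \<in> ?T" "X \<subseteq> A" "Z \<subseteq> C" by auto
    have YB: "(X \<union> Y \<union> Z) \<inter> B = Y" and "(X \<union> Y \<union> Z) \<inter> A = X" "(X \<union> Y \<union> Z) \<inter> C = Z"
      using p disj by auto
    with YB show "(\<lambda>Z. (Z \<inter> B, Z \<inter> A, Z \<inter> C)) (case p of (Y, X, Z) \<Rightarrow> X \<union> Y \<union> Z) = p"
      using p by simp
    have XYZ: "X \<union> Y \<union> Z \<subseteq> S" using p by (auto simp: S_def)
    have "u < z" if "u \<in> S - (X \<union> Y \<union> Z)" "z \<in> X \<union> Y \<union> Z" "u \<in> {a..c}" "z \<in> {a..c}" for u z
    proof -
      have "u \<in> B - Y" "z \<in> Y"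
        using that inB[of u] inB[of z] XYZ YB by blast+
      then show ?thesis using p by auto
    qed
    with XYZ show "(case p of (Y, X, Z) \<Rightarrow> X \<union> Y \<union> Z) \<in> zero_sets a c S"
      unfolding zero_sets_def p(1) by simp
  qed
  also have "\<dots> = (\<Sum>Y\<in>?T. \<Sum>X\<in>Pow A. ?s A X * (\<Sum>Z\<in>Pow C. ?s C Z * ?h X Y Z))"
    by (simp add: sum.cartesian_product sum_distrib_left)
  also have "\<dots> = (\<Sum>Y\<in>?T. (1 / (1 - x\<^sup>2)) ^ (card A div 2) * (1 / (1 - x\<^sup>2)) ^ (card C div 2) *
      (\<Sum>e\<le>card A mod 2. \<Sum>e'\<le>card C mod 2. shifted_gf x (card A) (card B) e (card (B - Y)) e'))"
  proof (rule sum.cong[OF refl])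
    fix Y
    let ?d = "1 / (1 - x\<^sup>2)"
    \<comment> \<open>First the zero set in \<open>C\<close> is summed for fixed \<open>X\<close>,
      then the one in \<open>A\<close>.\<close>
    have "(\<Sum>Z\<in>Pow C. ?s C Z * ?h X Y Z) = ?d ^ (card C div 2) *
        (\<Sum>e'\<le>card C mod 2. shifted_gf x (card A) (card B) (card (A - X)) (card (B - Y)) e')" for X
      by (rule signed_sum_subsets[OF fin(3), where
            g = "shifted_gf x (card A) (card B) (card (A - X)) (card (B - Y))"])
        (rule shifted_gf_right, rule nz)
    moreover have "(\<Sum>X\<in>Pow A. ?s A X *
        (\<Sum>e'\<le>card C mod 2. shifted_gf x (card A) (card B) (card (A - X)) (card (B - Y)) e')) =
        ?d ^ (card A div 2) * (\<Sum>e\<le>card A mod 2.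
          \<Sum>e'\<le>card C mod 2. shifted_gf x (card A) (card B) e (card (B - Y)) e')"
      by (rule signed_sum_subsets[OF fin(1), where
            g = "\<lambda>L'. \<Sum>e'\<le>card C mod 2. shifted_gf x (card A) (card B) L' (card (B - Y)) e'"])
        (simp only: sum.distrib[symmetric] sum_distrib_left shifted_gf_left[OF nz])
    ultimately show "(\<Sum>X\<in>Pow A. ?s A X * (\<Sum>Z\<in>Pow C. ?s C Z * ?h X Y Z)) =
        ?d ^ (card A div 2) * ?d ^ (card C div 2) *
        (\<Sum>e\<le>card A mod 2. \<Sum>e'\<le>card C mod 2. shifted_gf x (card A) (card B) e (card (B - Y)) e')"
      by (simp add: mult.left_commute[of _ "?d ^ (card C div 2)"] sum_distrib_left[symmetric] mult.assoc
          del: power_one_over)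
  qed
  also have "\<dots> = (1 / (1 - x\<^sup>2)) ^ (card A div 2) * (1 / (1 - x\<^sup>2)) ^ (card C div 2) *
      (\<Sum>k'\<le>card B. \<Sum>e\<le>card A mod 2. \<Sum>e'\<le>card C mod 2. shifted_gf x (card A) (card B) e k' e')"
    unfolding sum_distrib_left[symmetric] by (subst sum_final_segments[OF fin(2)]) (rule refl)
  also have "\<dots> = block_gf x (card A) (card B) (card C)"
    by (simp only: sum_shifted_gf[OF nz] block_gf_mod[OF nz, of "card A" "card B" "card C"])
  finally show ?thesis .
qed

text \<open>By \<open>signed_gf_rec\<close> and \<open>sum_zero_sets_block_gf\<close> both sides
  satisfy the same recursion. In the difference, induction on the size of \<open>S\<close> removes
  all terms with nonempty \<open>Z\<close>.\<close>

lemma signed_gf_eq_block_gf: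
  fixes x :: "'a::field" and S :: "nat set"
  assumes nz: "\<And>m. m \<ge> 1 \<Longrightarrow> x ^ m \<noteq> 1"
    and "finite S" "a \<le> Suc c"
  shows "signed_gf x a c S =
    block_gf x (card (S \<inter> {..<a})) (card (S \<inter> {a..c})) (card (S \<inter> {c<..}))"
  using assms(2)
proof (induct "card S" arbitrary: S rule: less_induct)
  case less
  let ?b = "\<lambda>S. block_gf x (card (S \<inter> {..<a})) (card (S \<inter> {a..c})) (card (S \<inter> {c<..}))"
  let ?w = "\<lambda>Z. (-1) ^ cross (S - Z) Z * x ^ card (S - Z)"
  have S: "S \<inter> {..<a} \<union> S \<inter> {a..c} \<union> S \<inter> {c<..} = S" using \<open>a \<le> Suc c\<close> by auto
  have diff: "(S - Z) \<inter> T = S \<inter> T - Z" for Z T by auto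
  have "(\<Sum>Z\<in>zero_sets a c S. ?w Z * ?b (S - Z)) = ?b S"
    using sum_zero_sets_block_gf[OF nz, of "S \<inter> {..<a}" "S \<inter> {a..c}" "S \<inter> {c<..}" a c] less.prems
      \<open>a \<le> Suc c\<close> unfolding S diff by simp
  then have "signed_gf x a c S - ?b S =
      (\<Sum>Z\<in>zero_sets a c S. ?w Z * (signed_gf x a c (S - Z) - ?b (S - Z)))"
    using signed_gf_rec[OF nz less.prems, of a c] by (simp add: sum_subtractf right_diff_distrib)
  also have "\<dots> = (\<Sum>Z\<in>{{}}. ?w Z * (signed_gf x a c (S - Z) - ?b (S - Z)))"
  proof (rule sum.mono_neutral_right)
    show "finite (zero_sets a c S)" by (rule finite_zero_sets[OF less.prems])
    show "\<forall>Z\<in>zero_sets a c S - {{}}. ?w Z * (signed_gf x a c (S - Z) - ?b (S - Z)) = 0"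
    proof
      fix Z assume "Z \<in> zero_sets a c S - {{}}"
      then have "S - Z \<subset> S" by (auto simp: zero_sets_def)
      then have "card (S - Z) < card S" by (rule psubset_card_mono[OF less.prems])
      then show "?w Z * (signed_gf x a c (S - Z) - ?b (S - Z)) = 0"
        using less.hyps[of "S - Z"] less.prems by simp
    qed
  qed (auto simp: zero_sets_def)
  \<comment> \<open>The term \<open>Z = {}\<close> is the difference itself with the factor
    \<open>x ^ card S\<close>.\<close>
  finally have eq: "(1 - x ^ card S) * (signed_gf x a c S - ?b S) = 0"
    by (simp add: algebra_simps)
  \<comment> \<open>The factor \<open>1 - x ^ card S\<close> is zero for empty \<open>S\<close>, so
    that case is computed directly.\<close>
  show ?case
  proof (cases "S = {}")
    case True
    have "arrangements a c {} = {[]}" by (auto simp: arrangements_def)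
    then show ?thesis
      using True by (simp add: signed_gf_def block_gf_def word_gf_def inv_num_def)
  next
    case False
    then have "card S \<ge> 1" using less.prems by (simp add: Suc_le_eq card_gt_0_iff)
    then show ?thesis using eq nz[of "card S"] by simp
  qed
qed

section \<open>Colored permutations containing the block\<close>

text \<open>Each letter of the block occurs exactly once, so the filtered list is the only candidate
  for the subsequence, and it equals \<open>[a..<Suc c]\<close> exactly when it is sorted.\<close>

lemma mem_H_set_iff:
  assumes "1 \<le> a" "c \<le> n"
  shows "p \<in> H_set r n a c \<longleftrightarrow> map fst p \<in> arrangements a c {1..n} \<and> set (map snd p) \<subseteq> {..<r}"
proof -
  have "subseq [a..<Suc c] \<sigma> \<longleftrightarrow> sorted (filter (\<lambda>s. s \<in> {a..c}) \<sigma>)"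
    if \<sigma>: "distinct \<sigma>" "set \<sigma> = {1..n}" for \<sigma>
  proof -
    let ?f = "filter (\<lambda>s. s \<in> {a..c})"
    have set: "set (?f \<sigma>) = set [a..<Suc c]" using \<sigma> assms by auto
    have len: "length (?f \<sigma>) = length [a..<Suc c]"
      using set \<sigma> by (metis distinct_card distinct_filter distinct_upt)
    have "?f [a..<Suc c] = [a..<Suc c]" by (rule filter_True) auto
    then have "subseq [a..<Suc c] \<sigma> \<Longrightarrow> [a..<Suc c] = ?f \<sigma>"
      using subseq_same_length[OF _ len[symmetric]] subseq_filter[of "[a..<Suc c]" \<sigma>] by metis
    moreover have "?f \<sigma> = [a..<Suc c]" if "sorted (?f \<sigma>)"
      using sorted_distinct_set_unique[OF that _ sorted_upt distinct_upt set] \<sigma> by simp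
    ultimately show ?thesis
      using subseq_filter_left sorted_upt by metis
  qed
  then show ?thesis
    by (auto simp: H_set_def colored_perms_def arrangements_def permutations_of_set_def underlying_def)
qed

text \<open>The colors are summed by \<open>sum_colorings\<close> for each underlying permutation;
  \<open>qpoch x n\<close> cancels the denominator of \<open>word_gf\<close>.\<close>

lemma sum_H_set:
  fixes x :: "'a::field"
  assumes nz: "\<And>m. m \<ge> 1 \<Longrightarrow> x ^ m \<noteq> 1" and "1 \<le> a" "c \<le> n"
  shows "(\<Sum>p\<in>H_set r n a c. (-1) ^ inv_num (underlying p) * x ^ fmaj r p) =
    qpoch x n * signed_gf x a c {1..n} * (\<Prod>i=1..n. bracket r (x ^ i))"
proof -
  let ?L = "\<lambda>\<sigma>. {zs. set zs \<subseteq> {..<r} \<and> length zs = length \<sigma>}"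
  let ?A = "arrangements a c {1..n}"
  have fin: "finite (?L \<sigma>)" for \<sigma> :: "nat list"
    by (rule finite_lists_length_eq) simp
  have "(\<Sum>p\<in>H_set r n a c. (-1) ^ inv_num (underlying p) * x ^ fmaj r p) =
      (\<Sum>(\<sigma>, zs)\<in>Sigma ?A ?L. (-1) ^ inv_num \<sigma> * x ^ fmaj_diffs r 1 (zip \<sigma> zs))"
  proof (rule sum.reindex_bij_witness[of _ "\<lambda>(\<sigma>, zs). zip \<sigma> zs" "\<lambda>p. (map fst p, map snd p)"])
    fix p assume p: "p \<in> H_set r n a c"
    then show "(map fst p, map snd p) \<in> Sigma ?A ?L"
      using mem_H_set_iff[OF assms(2,3)] by auto
    have "fmaj r p = fmaj_diffs r 1 p"
      using p mem_H_set_iff[OF assms(2,3)] by (intro fmaj_eq_diffs) auto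
    then show "(case (map fst p, map snd p) of (\<sigma>, zs) \<Rightarrow>
        (-1) ^ inv_num \<sigma> * x ^ fmaj_diffs r 1 (zip \<sigma> zs)) =
        (-1) ^ inv_num (underlying p) * x ^ fmaj r p"
      by (simp add: underlying_def zip_map_fst_snd)
  qed (auto simp: mem_H_set_iff[OF assms(2,3)] zip_map_fst_snd dest!: set_zip_rightD)
  also have "\<dots> = (\<Sum>\<sigma>\<in>?A. (-1) ^ inv_num \<sigma> * (\<Sum>zs\<in>?L \<sigma>. x ^ fmaj_diffs r 1 (zip \<sigma> zs)))"
    unfolding sum_distrib_left using fin finite_arrangements by (intro sum.Sigma[symmetric]) auto
  also have "\<dots> = (\<Sum>\<sigma>\<in>?A. (-1) ^ inv_num \<sigma> *
      (x ^ desc_sum (<) 1 \<sigma> * (\<Prod>j<length \<sigma>. bracket r (x ^ (1 + j)))))"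
    unfolding sum_colorings ..
  also have "\<dots> = (\<Sum>\<sigma>\<in>?A. qpoch x n * ((-1) ^ inv_num \<sigma> * word_gf x \<sigma>) *
      (\<Prod>i=1..n. bracket r (x ^ i)))"
  proof (rule sum.cong[OF refl])
    fix \<sigma> assume "\<sigma> \<in> ?A"
    then have "length \<sigma> = n" using distinct_card[of \<sigma>] by (simp add: arrangements_def)
    then show "(-1) ^ inv_num \<sigma> * (x ^ desc_sum (<) 1 \<sigma> * (\<Prod>j<length \<sigma>. bracket r (x ^ (1 + j)))) =
        qpoch x n * ((-1) ^ inv_num \<sigma> * word_gf x \<sigma>) * (\<Prod>i=1..n. bracket r (x ^ i))"
      using qpoch_nonzero[OF nz, of n] by (simp add: word_gf_def prod.atLeast1_atMost_eq)
  qed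
  finally show ?thesis
    by (simp add: signed_gf_def sum_distrib_left sum_distrib_right)
qed

section \<open>Brackets at signed arguments\<close>

definition sign_qpoch :: "'a::field \<Rightarrow> nat \<Rightarrow> 'a" where
  "sign_qpoch x n = (\<Prod>i=1..n. 1 - (-1) ^ (i - 1) * x)"

text \<open>Consecutive factors \<open>1 - x\<close> and \<open>1 + x\<close> pair up.\<close>

lemma sign_qpoch_even: "sign_qpoch x (2 * m) = (1 - x\<^sup>2) ^ m"
  by (induct m) (simp_all add: sign_qpoch_def power2_eq_square algebra_simps)

lemma sign_qpoch_odd: "sign_qpoch x (Suc (2 * m)) = (1 - x\<^sup>2) ^ m * (1 - x)"
  using sign_qpoch_even[of x m] by (simp add: sign_qpoch_def)

lemma one_minus_mult_bracket: "(1 - y) * bracket m y = 1 - (y :: 'a::comm_ring_1) ^ m"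
  by (simp add: bracket_def one_diff_power_eq)

context
  fixes x :: "'a::field"
  assumes nz: "\<And>m. m \<ge> 1 \<Longrightarrow> x ^ m \<noteq> 1"
begin

lemma signed_neq_1: "(-1) ^ j * x \<noteq> 1"
proof
  assume "(-1) ^ j * x = 1"
  then have "((-1) ^ j * x)\<^sup>2 = 1" by simp
  then show False using nz[of 2] by (simp add: power_mult_distrib flip: power_mult)
qed

lemma bracket_mult_signed:
  assumes "i \<ge> 1"
  shows "bracket (i * r) ((-1) ^ (i - 1) * x) = (1 - x ^ i) / (1 - (-1) ^ (i - 1) * x) * bracket r (x ^ i)"
proof -
  define y where "y = (-1) ^ (i - 1) * x"
  \<comment> \<open>The sign is \<open>(-1) ^ (i * (i - 1))\<close>, and \<open>i * (i - 1)\<close>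
    is even.\<close>
  have "y ^ i = x ^ i"
    by (simp add: y_def power_mult_distrib minus_one_power_iff flip: power_mult)
  then have "(1 - y) * bracket (i * r) y = (1 - x ^ i) * bracket r (x ^ i)"
    by (simp only: one_minus_mult_bracket power_mult)
  moreover have "1 - y \<noteq> 0" using signed_neq_1 by (simp add: y_def)
  ultimately show ?thesis
    unfolding y_def[symmetric] by (simp add: nonzero_eq_divide_eq mult.commute)
qed

text \<open>\<open>sign_qpoch\<close> collects the denominators \<open>1 - y\<close> of the brackets
  at \<open>y = (-1) ^ (i - 1) * x\<close>.\<close>

lemma prod_bracket_signed:
  "(\<Prod>i=1..n. bracket (i * r) ((-1) ^ (i - 1) * x)) =
    qpoch x n / sign_qpoch x n * (\<Prod>i=1..n. bracket r (x ^ i))"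
proof -
  have "(\<Prod>i=1..n. bracket (i * r) ((-1) ^ (i - 1) * x)) =
      (\<Prod>i=1..n. (1 - x ^ i) / (1 - (-1) ^ (i - 1) * x) * bracket r (x ^ i))"
    by (rule prod.cong[OF refl], rule bracket_mult_signed) simp
  then show ?thesis
    unfolding qpoch_def sign_qpoch_def by (simp only: prod.distrib prod_dividef)
qed

lemma prod_bracket_signed_1:
  "(\<Prod>i=1..n. bracket i ((-1) ^ (i - 1) * x)) = qpoch x n / sign_qpoch x n"
  using prod_bracket_signed[of 1 n] by (simp add: bracket_def)

lemma bracket_odd_signed:
  assumes "even k"
  shows "bracket (Suc k) ((-1) ^ n * x) = (1 - (-1) ^ n * (x * x ^ k)) / (1 - (-1) ^ n * x)"
proof -
  define y where "y = (-1) ^ n * x"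
  \<comment> \<open>\<open>Suc k\<close> is odd, so the power keeps the sign
    \<open>(-1) ^ n\<close>.\<close>
  have "y ^ Suc k = (-1) ^ n * (x * x ^ k)"
    using assms by (simp add: y_def minus_one_power_iff)
  then have "(1 - y) * bracket (Suc k) y = 1 - (-1) ^ n * (x * x ^ k)"
    by (simp only: one_minus_mult_bracket)
  moreover have "1 - y \<noteq> 0" using signed_neq_1 by (simp add: y_def)
  ultimately show ?thesis
    unfolding y_def[symmetric] by (simp add: nonzero_eq_divide_eq mult.commute)
qed

text \<open>Apart from \<open>1 / qpoch x k\<close> only powers of \<open>1 - x\<close> and
  \<open>1 + x\<close> occur, and the parities of \<open>L\<close> and \<open>R\<close> fix that of
  \<open>L + k + R\<close>, hence the shape of \<open>sign_qpoch\<close>.\<close>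

lemma block_gf_formula_odd:
  assumes "odd k"
  shows "block_gf x L k R = sign_qpoch x k / (sign_qpoch x (L + k + R) * qpoch x k)"
proof -
  obtain m where k: "k = Suc (2 * m)" using assms by (auto elim: oddE)
  have w: "1 - x\<^sup>2 = (1 - x) * (1 + x)" by (rule one_minus_square, rule nz)
  have n: "1 - x \<noteq> 0" "1 + x \<noteq> 0" by (rule nonzeros, rule nz, assumption)+
  consider l t where "L = 2 * l" "R = 2 * t" | l t where "L = Suc (2 * l)" "R = 2 * t"
    | l t where "L = 2 * l" "R = Suc (2 * t)" | l t where "L = Suc (2 * l)" "R = Suc (2 * t)"
    by (metis evenE oddE Suc_eq_plus1)
  then show ?thesis
  proof cases
    case 1
    have *: "L + k + R = Suc (2 * (l + m + t))" using 1 k by simp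
    show ?thesis
      unfolding block_gf_def * sign_qpoch_odd sign_qpoch_even unfolding k sign_qpoch_odd w
      using 1 n by (simp add: power_add)
  next
    case 2
    have *: "L + k + R = 2 * Suc (l + m + t)" using 2 k by simp
    show ?thesis
      unfolding block_gf_def * sign_qpoch_odd sign_qpoch_even unfolding k sign_qpoch_odd w
      using 2 n by (simp add: power_add)
  next
    case 3
    have *: "L + k + R = 2 * Suc (l + m + t)" using 3 k by simp
    show ?thesis
      unfolding block_gf_def * sign_qpoch_odd sign_qpoch_even unfolding k sign_qpoch_odd w
      using 3 n by (simp add: power_add)
  next
    case 4
    have *: "L + k + R = Suc (2 * Suc (l + m + t))" using 4 k by simp
    show ?thesis
      unfolding block_gf_def * sign_qpoch_odd sign_qpoch_even unfolding k sign_qpoch_odd w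
      using 4 n by (simp add: power_add)
  qed
qed

text \<open>\<open>B\<close> is \<open>(1 + x ^ Suc k) / (1 + x)\<close> if \<open>L + R\<close> is
  odd and \<open>(1 - x ^ Suc k) / (1 - x)\<close> if it is even. The unusual numerators of
  \<open>block_gf\<close> for odd \<open>R\<close> are those of \<open>2 - B\<close>.\<close>

lemma block_gf_formula_even:
  fixes L k R :: nat
  assumes "even k"
  defines "B \<equiv> bracket (Suc k) ((-1) ^ (L + k + R) * x)"
  shows "block_gf x L k R = sign_qpoch x (Suc k) / (sign_qpoch x (L + k + R) * qpoch x (Suc k)) *
    (if even R then B else 2 - B)"
proof -
  obtain m where k: "k = 2 * m" using assms by (auto elim: evenE)
  have w: "1 - x\<^sup>2 = (1 - x) * (1 + x)" by (rule one_minus_square, rule nz)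
  have n: "1 - x \<noteq> 0" "1 + x \<noteq> 0" "1 - x * x ^ k \<noteq> 0" by (rule nonzeros, rule nz, assumption)+
  note B = B_def[unfolded bracket_odd_signed[OF \<open>even k\<close>]]
  consider l t where "L = 2 * l" "R = 2 * t" | l t where "L = Suc (2 * l)" "R = 2 * t"
    | l t where "L = 2 * l" "R = Suc (2 * t)" | l t where "L = Suc (2 * l)" "R = Suc (2 * t)"
    by (metis evenE oddE Suc_eq_plus1)
  then show ?thesis
  proof cases
    case 1
    have *: "L + k + R = 2 * (l + m + t)" using 1 k by simp
    show ?thesis
      unfolding block_gf_def B * sign_qpoch_even unfolding k sign_qpoch_odd w
      using 1 n k by (simp add: qpoch_Suc power_add)
  next
    case 2
    have *: "L + k + R = Suc (2 * (l + m + t))" using 2 k by simp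
    show ?thesis
      unfolding block_gf_def B * sign_qpoch_odd unfolding k sign_qpoch_odd w
      using 2 n k by (simp add: power_add)
  next
    case 3
    have *: "L + k + R = Suc (2 * (l + m + t))" using 3 k by simp
    have B': "2 - B = (1 + 2 * x - x * x ^ k) / (1 + x)"
      unfolding B * using n by (simp add: field_simps)
    show ?thesis
      unfolding block_gf_def * sign_qpoch_odd unfolding k sign_qpoch_odd w
      using 3 n k B' by (simp add: power_add)
  next
    case 4
    have *: "L + k + R = 2 * Suc (l + m + t)" using 4 k by simp
    have B': "2 - B = (1 - 2 * x + x * x ^ k) / (1 - x)"
      unfolding B * using n by (simp add: field_simps)
    show ?thesis
      unfolding block_gf_def * sign_qpoch_even unfolding k sign_qpoch_odd w
      using 4 n k B' by (simp add: power_add)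
  qed
qed

end

section \<open>Specialization to the field of rational functions\<close>

lemma const_mult: "const a * const b = const (a * b)"
  by (simp add: const_def mult.commute)

lemma const_1: "const 1 = 1"
  by (simp add: const_def One_fract_def one_pCons)

lemma const_power: "const a ^ m = const (a ^ m)"
  by (induct m) (simp_all add: const_1 const_mult)

lemma const_minus_1: "const (- 1) = - 1"
  by (simp add: const_def One_fract_def one_pCons)

text \<open>The power is a polynomial in \<open>q\<close> without constant term; evaluation at 0
  separates it from 1.\<close>

lemma const_q_power_neq_1:
  assumes "m \<ge> 1"
  shows "(const z * q) ^ m \<noteq> 1"
proof
  assume "(const z * q) ^ m = 1"
  moreover have "(const z * q) ^ j = Fract ([:0, z:] ^ j) 1" for j
    by (induct j) (simp_all add: const_def q_def One_fract_def)
  ultimately have "[:0, z:] ^ m = 1"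
    by (simp add: One_fract_def eq_fract)
  then have "poly ([:0, z:] ^ m) 0 = 1" by simp
  then show False using assms by (auto simp: poly_power power_0_left)
qed

text \<open>\<open>fmaj r p\<close> and \<open>col p\<close> agree modulo \<open>r\<close>, so
  \<open>\<zeta> ^ h\<close> can be absorbed into the indeterminate.\<close>

lemma chi_q_power:
  assumes "\<zeta> ^ r = 1"
  shows "const (chi \<zeta> (-1) h p) * q ^ fmaj r p =
    (-1) ^ inv_num (underlying p) * (const (\<zeta> ^ h) * q) ^ fmaj r p"
proof -
  have "(\<zeta> ^ h) ^ fmaj r p = (\<zeta> ^ r) ^ (h * maj_F p) * \<zeta> ^ (h * col p)"
    by (simp add: fmaj_def distrib_left ac_simps flip: power_mult power_add)
  then have "(\<zeta> ^ h) ^ fmaj r p = \<zeta> ^ (h * col p)" using assms by simp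
  then show ?thesis
    by (simp add: chi_def power_mult_distrib const_power flip: const_mult const_minus_1)
qed

theorem theorem2p5:
  fixes r n h k b :: nat and \<zeta> :: complex
  assumes "r \<ge> 1" and "n \<ge> 1"
    and "primitive_root_of_unity r \<zeta>"
    and "h < r"
    and "1 \<le> k" and "k \<le> n - 1"
    and "k \<le> b" and "b \<le> n"
  shows
    "(odd k \<longrightarrow>
       (\<Sum>p \<in> H_set r n (b - k + 1) b. const (chi \<zeta> (-1) h p) * q ^ fmaj r p) =
       (\<Prod>i = 1..n. bracket (i * r) ((-1) ^ (i - 1) * const (\<zeta> ^ h) * q)) /
       (\<Prod>i = 1..k. bracket i ((-1) ^ (i - 1) * const (\<zeta> ^ h) * q))) \<and>
     (even k \<and> even (n - b) \<longrightarrow>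
       (\<Sum>p \<in> H_set r n (b - k + 1) b. const (chi \<zeta> (-1) h p) * q ^ fmaj r p) =
       (\<Prod>i = 1..n. bracket (i * r) ((-1) ^ (i - 1) * const (\<zeta> ^ h) * q)) /
       (\<Prod>i = 1..k + 1. bracket i ((-1) ^ (i - 1) * const (\<zeta> ^ h) * q)) *
       bracket (k + 1) ((-1) ^ n * const (\<zeta> ^ h) * q)) \<and>
     (even k \<and> odd (n - b) \<longrightarrow>
       (\<Sum>p \<in> H_set r n (b - k + 1) b. const (chi \<zeta> (-1) h p) * q ^ fmaj r p) =
       (\<Prod>i = 1..n. bracket (i * r) ((-1) ^ (i - 1) * const (\<zeta> ^ h) * q)) /
       (\<Prod>i = 1..k + 1. bracket i ((-1) ^ (i - 1) * const (\<zeta> ^ h) * q)) *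
       (2 - bracket (k + 1) ((-1) ^ n * const (\<zeta> ^ h) * q)))"
proof -
  define x where "x = const (\<zeta> ^ h) * q"
  have nz: "\<And>m. m \<ge> 1 \<Longrightarrow> x ^ m \<noteq> 1"
    unfolding x_def by (rule const_q_power_neq_1)
  have root: "\<zeta> ^ r = 1" using assms(3) by (simp add: primitive_root_of_unity_def)
  \<comment> \<open>These are the arguments \<open>L\<close>, \<open>k\<close> and \<open>R\<close>
    of \<open>block_gf\<close>.\<close>
  have cards: "card ({1..n} \<inter> {..<b - k + 1}) = b - k" "card ({1..n} \<inter> {b - k + 1..b}) = k"
      "card ({1..n} \<inter> {b<..}) = n - b"
  proof -
    have "{1..n} \<inter> {..<b - k + 1} = {1..b - k}" "{1..n} \<inter> {b - k + 1..b} = {b - k + 1..b}"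
        "{1..n} \<inter> {b<..} = {b + 1..n}"
      using assms by auto
    then show "card ({1..n} \<inter> {..<b - k + 1}) = b - k" "card ({1..n} \<inter> {b - k + 1..b}) = k"
      "card ({1..n} \<inter> {b<..}) = n - b"
      using assms by simp_all
  qed
  have total: "b - k + k + (n - b) = n" using assms by simp
  let ?R = "\<Prod>i=1..n. bracket r (x ^ i)"
  have sum: "(\<Sum>p\<in>H_set r n (b - k + 1) b. const (chi \<zeta> (-1) h p) * q ^ fmaj r p) =
      qpoch x n * block_gf x (b - k) k (n - b) * ?R"
  proof -
    have "(\<Sum>p\<in>H_set r n (b - k + 1) b. const (chi \<zeta> (-1) h p) * q ^ fmaj r p) =
        qpoch x n * signed_gf x (b - k + 1) b {1..n} * ?R"
      unfolding chi_q_power[OF root] x_def[symmetric]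
      by (rule sum_H_set[OF nz]) (use assms in simp_all)
    also have "signed_gf x (b - k + 1) b {1..n} = block_gf x (b - k) k (n - b)"
      by (subst signed_gf_eq_block_gf, rule nz, assumption, simp, simp, simp only: cards)
    finally show ?thesis .
  qed
  have y: "(-1) ^ i * const (\<zeta> ^ h) * q = (-1) ^ i * x" for i
    by (simp add: x_def mult.assoc)
  have num: "(\<Prod>i=1..n. bracket (i * r) ((-1) ^ (i - 1) * x)) = qpoch x n / sign_qpoch x n * ?R"
    by (rule prod_bracket_signed, rule nz)
  have den: "(\<Prod>i=1..m. bracket i ((-1) ^ (i - 1) * x)) = qpoch x m / sign_qpoch x m" for m
    by (rule prod_bracket_signed_1, rule nz)
  have odd: "block_gf x (b - k) k (n - b) = sign_qpoch x k / (sign_qpoch x n * qpoch x k)" if "odd k"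
    by (subst block_gf_formula_odd, rule nz, assumption, rule that, unfold total, rule refl)
  have even: "block_gf x (b - k) k (n - b) = sign_qpoch x (k + 1) / (sign_qpoch x n * qpoch x (k + 1)) *
      (if even (n - b) then bracket (k + 1) ((-1) ^ n * x) else 2 - bracket (k + 1) ((-1) ^ n * x))"
    if "even k"
    by (subst block_gf_formula_even, rule nz, assumption, rule that, unfold total Suc_eq_plus1, rule refl)
  \<comment> \<open>Common rearrangement for the three cases: \<open>m = k\<close> and
    \<open>c = 1\<close> for odd \<open>k\<close>, while for even \<open>k\<close> it is
    \<open>m = k + 1\<close> and \<open>c\<close> is the factor with the last bracket.\<close>
  have combine: "qpoch x n * (sign_qpoch x m / (sign_qpoch x n * qpoch x m) * c) * ?R =
      qpoch x n / sign_qpoch x n * ?R / (qpoch x m / sign_qpoch x m) * c" for m c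
    by (simp add: mult_ac)
  show ?thesis
  proof (intro conjI impI)
    assume "odd k"
    then show "(\<Sum>p \<in> H_set r n (b - k + 1) b. const (chi \<zeta> (-1) h p) * q ^ fmaj r p) =
       (\<Prod>i = 1..n. bracket (i * r) ((-1) ^ (i - 1) * const (\<zeta> ^ h) * q)) /
       (\<Prod>i = 1..k. bracket i ((-1) ^ (i - 1) * const (\<zeta> ^ h) * q))"
      unfolding sum y num den odd[OF \<open>odd k\<close>] using combine[of k 1] by (simp only: mult_1_right)
  next
    assume k: "even k \<and> even (n - b)"
    show "(\<Sum>p \<in> H_set r n (b - k + 1) b. const (chi \<zeta> (-1) h p) * q ^ fmaj r p) =
       (\<Prod>i = 1..n. bracket (i * r) ((-1) ^ (i - 1) * const (\<zeta> ^ h) * q)) /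
       (\<Prod>i = 1..k + 1. bracket i ((-1) ^ (i - 1) * const (\<zeta> ^ h) * q)) *
       bracket (k + 1) ((-1) ^ n * const (\<zeta> ^ h) * q)"
      unfolding sum y num den even[OF k[THEN conjunct1]] combine using k by (simp only: if_True)
  next
    assume k: "even k \<and> odd (n - b)"
    show "(\<Sum>p \<in> H_set r n (b - k + 1) b. const (chi \<zeta> (-1) h p) * q ^ fmaj r p) =
       (\<Prod>i = 1..n. bracket (i * r) ((-1) ^ (i - 1) * const (\<zeta> ^ h) * q)) /
       (\<Prod>i = 1..k + 1. bracket i ((-1) ^ (i - 1) * const (\<zeta> ^ h) * q)) *
       (2 - bracket (k + 1) ((-1) ^ n * const (\<zeta> ^ h) * q))"
      unfolding sum y num den even[OF k[THEN conjunct1]] combine using k by (simp only: if_False)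
  qed
qed

end
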